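(* Let $\mathcal{K}$ be a finite index set and let $\{Q_k\}_{k\in\mathcal{K}},A,B\in\mathbb{C}[x_1,\ldots,x_n]$ be homogeneous polynomials of degree $2$ such that $\prod_{k\in\mathcal{K}}Q_k\in\sqrt{\langle A,B\rangle}$ (equivalently, $\prod_{k}Q_k$ vanishes at every common zero of $A$ and $B$ in $\mathbb{C}^n$). Then at least one of the following holds: (i) there is $k\in\mathcal{K}$ such that $Q_k$ is in the linear span of $A$ and $B$; (ii) there exists a non-trivial linear combination $\alpha A+\beta B=c\cdot d$ where $c$ and $d$ are linear forms; (iii) there exist two linear forms $c$ and $d$ such that, when setting $c=d=0$, $A$, $B$ and one of the polynomials $Q_k$ ($k\in\mathcal{K}$) all vanish identically (i.e., $A$, $B$ and some $Q_k$ lie in the ideal $\langle c,d\rangle$).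
   Context: $\langle A,B\rangle$ denotes the ideal of $\mathbb{C}[x_1,\ldots,x_n]$ generated by $A$ and $B$, and $\sqrt{I}$ the radical of an ideal $I$. Linear forms are homogeneous polynomials of degree $1$. *)

theory Defs
  imports Complex_Main "HOL-Library.Poly_Mapping"
begin

text \<open>
  A monomial in the variables indexed by \<open>'n\<close> is its exponent vector \<open>'n \<Rightarrow>\<^sub>0 nat\<close>, and the
  convolution product of \<^theory>\<open>HOL-Library.Poly_Mapping\<close> makes the following type the
  polynomial ring over the complex numbers. For a finite type \<open>'n\<close> with \<open>n\<close> elements this is
  the ring in \<open>n\<close> variables.
\<close>
type_synonym 'n cpoly = "('n \<Rightarrow>\<^sub>0 nat) \<Rightarrow>\<^sub>0 complex"

definition mdeg :: "('n::finite \<Rightarrow>\<^sub>0 nat) \<Rightarrow> nat" where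
  "mdeg m = (\<Sum>i\<in>UNIV. Poly_Mapping.lookup m i)"

text \<open>The zero polynomial is homogeneous of every degree.\<close>
definition homogeneous :: "nat \<Rightarrow> ('n::finite) cpoly \<Rightarrow> bool" where
  "homogeneous d p \<longleftrightarrow> (\<forall>m\<in>Poly_Mapping.keys p. mdeg m = d)"

text \<open>
  Linear forms are required to be nonzero: otherwise the identity \<open>\<alpha>A + \<beta>B = c d\<close> would hold
  trivially, with \<open>c = 0\<close>, for linearly dependent \<open>A\<close> and \<open>B\<close>.
\<close>
definition linear_form :: "('n::finite) cpoly \<Rightarrow> bool" where
  "linear_form p \<longleftrightarrow> homogeneous 1 p \<and> p \<noteq> 0"

definition cscale :: "complex \<Rightarrow> 'n cpoly \<Rightarrow> 'n cpoly" where
  "cscale a p = Poly_Mapping.single 0 a * p"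

lemma module_cscale: "module (cscale :: complex \<Rightarrow> 'n cpoly \<Rightarrow> 'n cpoly)"
  by unfold_locales
    (simp_all add: cscale_def algebra_simps single_add mult_single flip: mult.assoc)

lemma lookup_cscale: "Poly_Mapping.lookup (cscale a p) m = a * Poly_Mapping.lookup p m"
proof -
  have "cscale a p = Poly_Mapping.map ((*) a) p"
    unfolding cscale_def by (rule mult_map_scale_conv_mult [symmetric])
  then show ?thesis
    by (simp add: Poly_Mapping.map.rep_eq when_def)
qed

lemma module_times: "module ((*) :: 'a \<Rightarrow> 'a \<Rightarrow> 'a::comm_ring_1)"
  by unfold_locales (simp_all add: algebra_simps)

definition clinear_span :: "'n cpoly set \<Rightarrow> 'n cpoly set" where
  "clinear_span = module.span cscale"

text \<open>The ideal generated by \<open>S\<close> is the submodule it spans in the ring over itself.\<close>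
definition ideal_gen :: "'a::comm_ring_1 set \<Rightarrow> 'a set" where
  "ideal_gen = module.span (*)"

definition radical :: "'a::comm_ring_1 set \<Rightarrow> 'a set" where
  "radical I = {p. \<exists>m>0. p ^ m \<in> I}"

lemma clinear_span_pair:
  "p \<in> clinear_span {A, B} \<longleftrightarrow> (\<exists>\<alpha> \<beta>. p = cscale \<alpha> A + cscale \<beta> B)"
proof -
  interpret module "cscale :: complex \<Rightarrow> 'a cpoly \<Rightarrow> 'a cpoly" by (rule module_cscale)
  show ?thesis
    by (auto simp: clinear_span_def span_insert algebra_simps)
qed

lemma ideal_gen_pair:
  "p \<in> ideal_gen {A, B} \<longleftrightarrow> (\<exists>r s. p = r * A + s * B)"
proof -
  interpret module "(*) :: 'a \<Rightarrow> 'a \<Rightarrow> 'a" by (rule module_times)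
  show ?thesis
    by (auto simp: ideal_gen_def span_insert algebra_simps)
qed

end

theory Submission
  imports Defs "HOL-Computational_Algebra.Polynomial"
begin

text \<open>
  Choose a point \<open>v\<close> and a basis \<open>A1\<close>, \<open>B1\<close> of the pencil with \<open>A1(v) = 1\<close>, \<open>B1(v) = 0\<close> and such that the
  polar form \<open>b\<close> of \<open>B1\<close> at \<open>v\<close> is nonzero. If \<open>2 x\<close> is the polar form of \<open>A1\<close>, then \<open>A1 = x\<^sup>2 - A0\<close> and
  \<open>B1 = x b + B0\<close>, and modulo \<open>A1\<close> one has \<open>Q\<^sub>k = x c\<^sub>k + D\<^sub>k\<close>. The substitution \<open>X \<mapsto> b X - B1 v\<close> kills \<open>B1\<close>, maps
  \<open>A1\<close> to the resultant \<open>F = B0\<^sup>2 - b\<^sup>2 A0\<close>, and maps \<open>Q\<^sub>k\<close> to \<open>b G\<^sub>k\<close> modulo \<open>F\<close>, where \<open>G\<^sub>k = b D\<^sub>k - B0 c\<^sub>k\<close>.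
  Hence every prime factor of the quartic \<open>F\<close> divides some \<open>b G\<^sub>k\<close>. If \<open>F\<close> is irreducible, some cubic
  \<open>G\<^sub>k\<close> vanishes and \<open>Q\<^sub>k\<close> lies in the pencil; a linear factor of \<open>F\<close> leads to (iii); and a factorization
  into two quadratics without linear factors produces a reducible member of the pencil.
\<close>

subsection \<open>Substitutions and homogeneity\<close>

text \<open>The substitution comes from geometry: the line joining a point \<open>X\<close> to
  \<open>v\<close> meets the quadric \<open>B1 = 0\<close> in \<open>v\<close> and in the second
  point \<open>b X - B1 v\<close>. So it parametrizes that quadric by projection from
  \<open>v\<close>, and \<open>F\<close> is the equation of the projection of its intersection with
  \<open>A1 = 0\<close>. Being a homomorphism, it acts on the ideal membership of a power of the
  product directly, without passing to common zeros. The factor \<open>b\<close> in the images of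
  the \<open>Q_k\<close> is harmless: if \<open>b\<close> divided \<open>F\<close>, it would divide
  \<open>B0\<close> and hence \<open>B1\<close>, which would be a reducible member of the pencil.
  The price is factorization theory in several variables, above all that irreducible polynomials are
  prime; it is built up by induction on the variables, with pseudo-division in place of fractions.
  Cancellation requires an integral domain, which is obtained from a linear order on the variables.
  Hence the argument runs over \<open>'v::linorder\<close> and is carried over to an unordered
  finite index type at the end.\<close>

definition ring_hom :: "('a::comm_ring_1 \<Rightarrow> 'b::comm_ring_1) \<Rightarrow> bool" where
  "ring_hom f \<longleftrightarrow> f 1 = 1 \<and> (\<forall>a b. f (a + b) = f a + f b) \<and> (\<forall>a b. f (a * b) = f a * f b)"

lemma ring_homD:
  assumes "ring_hom f"
  shows "f 1 = 1" "f (a + b) = f a + f b" "f (a * b) = f a * f b"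
    "f 0 = 0" "f (- a) = - f a" "f (a - b) = f a - f b" "f (a ^ n) = f a ^ n"
proof -
  show 1: "f 1 = 1" and 2: "f (a + b) = f a + f b" and 3: "f (a * b) = f a * f b" for a b
    using assms by (auto simp: ring_hom_def)
  show 4: "f 0 = 0" using 2[of 0 0] by simp
  show 5: "f (- a) = - f a" for a using 2[of a "-a"] 4 by (simp add: eq_neg_iff_add_eq_0 add.commute)
  show "f (a - b) = f a - f b" using 2[of a "-b"] 5 by simp
  show "f (a ^ n) = f a ^ n" by (induction n) (simp_all add: 1 3)
qed

lemma ring_hom_sum: "ring_hom f \<Longrightarrow> f (\<Sum>i\<in>I. g i) = (\<Sum>i\<in>I. f (g i))"
  by (induction I rule: infinite_finite_induct) (simp_all add: ring_homD)

lemma ring_hom_prod: "ring_hom f \<Longrightarrow> f (\<Prod>i\<in>I. g i) = (\<Prod>i\<in>I. f (g i))"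
  by (induction I rule: infinite_finite_induct) (simp_all add: ring_homD)

lemma ring_hom_dvd: "ring_hom f \<Longrightarrow> a dvd b \<Longrightarrow> f a dvd f b"
  by (auto simp: dvd_def ring_homD)

lemma ring_hom_comp: "ring_hom f \<Longrightarrow> ring_hom g \<Longrightarrow> ring_hom (\<lambda>x. f (g x))"
  by (simp add: ring_hom_def)

lemma ring_hom_ident: "ring_hom (\<lambda>x. x)"
  by (simp add: ring_hom_def)

lemma ring_hom_const_poly: "ring_hom (\<lambda>x. [:x:])"
  by (simp add: ring_hom_def one_pCons)

lemma ring_hom_poly: "ring_hom (\<lambda>p. poly p x)"
  by (simp add: ring_hom_def)

lemma ring_hom_map_poly:
  assumes "ring_hom f"
  shows "ring_hom (map_poly f)"
  unfolding ring_hom_def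
  by (auto intro!: poly_eqI simp: coeff_map_poly coeff_mult ring_homD[OF assms] ring_hom_sum[OF assms]
        map_poly_1')

section \<open>Constants and variables as generators of the polynomial ring\<close>

definition Cst :: "complex \<Rightarrow> 'v cpoly" where
  "Cst c = Poly_Mapping.single 0 c"

definition Var :: "'v \<Rightarrow> 'v cpoly" where
  "Var i = Poly_Mapping.single (Poly_Mapping.single i 1) 1"

lemma ring_hom_Cst: "ring_hom Cst"
  by (simp add: ring_hom_def Cst_def single_add mult_single)

lemmas Cst_simps [simp] =
  ring_homD(1,4)[OF ring_hom_Cst]

lemmas Cst_arith = ring_homD[OF ring_hom_Cst]

lemma Cst_eq_iff [simp]: "Cst a = Cst b \<longleftrightarrow> a = b"
  unfolding Cst_def by (metis lookup_single_eq)

lemma Cst_eq_0_iff [simp]: "Cst a = 0 \<longleftrightarrow> a = 0"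
  using Cst_eq_iff[of a 0] by (simp del: Cst_eq_iff)

lemma Cst_numeral [simp]: "Cst (numeral n) = numeral n"
  by (simp add: Cst_def)

lemma Cst_cancel [simp]: "c \<noteq> 0 \<Longrightarrow> Cst c * (Cst (inverse c) * p) = p"
    "c \<noteq> 0 \<Longrightarrow> Cst (inverse c) * (Cst c * p) = p"
  by (simp_all flip: mult.assoc Cst_arith(3))

lemma Cst_dvd_1: "c \<noteq> 0 \<Longrightarrow> Cst c dvd 1"
  using Cst_cancel(1)[of c 1] by (metis dvd_triv_left)

lemma monom_conv_Var_prod:
  assumes "finite I" "Poly_Mapping.keys m \<subseteq> I"
  shows "Poly_Mapping.single m c = Cst c * (\<Prod>i\<in>I. Var i ^ Poly_Mapping.lookup m i)"
proof -
  have V: "Var i ^ k = Poly_Mapping.single (Poly_Mapping.single i k) 1" for i :: 'a and k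
    by (induction k) (simp_all add: Var_def mult_single flip: single_add)
  have W: "(\<Prod>i\<in>I. Poly_Mapping.single (g i) (1::complex)) = Poly_Mapping.single (\<Sum>i\<in>I. g i) 1"
    for g :: "'a \<Rightarrow> 'a \<Rightarrow>\<^sub>0 nat"
    by (induction I rule: infinite_finite_induct) (simp_all add: mult_single)
  have "m = (\<Sum>i\<in>I. Poly_Mapping.single i (Poly_Mapping.lookup m i))"
    using assms by (intro poly_mapping_eqI)
      (auto simp: lookup_sum lookup_single when_def sum.delta' in_keys_iff)
  then show ?thesis
    by (simp add: V W Cst_def mult_single)
qed

lemma cpoly_decomp:
  fixes p :: "'v cpoly"
  shows "p = (\<Sum>m\<in>Poly_Mapping.keys p. Poly_Mapping.single m (Poly_Mapping.lookup p m))"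
  by (intro poly_mapping_eqI)
     (auto simp: lookup_sum lookup_single when_def sum.delta' in_keys_iff)

text \<open>Every monomial is a constant times a product of variable powers, so constants and
  variables generate the ring. Homomorphisms are therefore compared on generators only.\<close>

lemma cpoly_induct [case_names Cst Var add mult]:
  fixes p :: "'v cpoly"
  assumes "\<And>c. P (Cst c)" "\<And>i. P (Var i)"
    and add: "\<And>p q. P p \<Longrightarrow> P q \<Longrightarrow> P (p + q)" and mult: "\<And>p q. P p \<Longrightarrow> P q \<Longrightarrow> P (p * q)"
  shows "P p"
proof -
  have P0: "P 0" and P1: "P 1" using assms(1)[of 0] assms(1)[of 1] by simp_all
  have pow: "P (q ^ k)" if "P q" for q k
    using that by (induction k) (auto intro: mult P1)
  have prod: "P (\<Prod>i\<in>I. f i)" if "\<And>i. P (f i)" for f :: "'v \<Rightarrow> 'v cpoly" and I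
    using that by (induction I rule: infinite_finite_induct) (auto intro: mult P1)
  have "P (Poly_Mapping.single m c)" for m c
    by (subst monom_conv_Var_prod[of "Poly_Mapping.keys m"]) (auto intro!: mult assms prod pow)
  then have "P (\<Sum>m\<in>M. Poly_Mapping.single m (f m))" for M f
    by (induction M rule: infinite_finite_induct) (auto intro: add P0)
  then show ?thesis
    by (subst cpoly_decomp)
qed

lemma ring_hom_eqI:
  fixes f g :: "'v cpoly \<Rightarrow> 'b::comm_ring_1"
  assumes "ring_hom f" "ring_hom g" "\<And>c. f (Cst c) = g (Cst c)" "\<And>i. f (Var i) = g (Var i)"
  shows "f p = g p"
  by (induction p rule: cpoly_induct) (simp_all add: assms ring_homD)

text \<open>Target ring and coefficient map \<open>h\<close> stay free because one construction
  serves for \<open>grading\<close> and \<open>univ\<close> (into univariate polynomials), for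
  evaluation at a point (into the complex numbers) and for changes of variables.\<close>

definition psubst :: "(complex \<Rightarrow> 'b::comm_ring_1) \<Rightarrow> ('v \<Rightarrow> 'b) \<Rightarrow> 'v cpoly \<Rightarrow> 'b" where
  "psubst h s p = (\<Sum>m\<in>Poly_Mapping.keys p.
     h (Poly_Mapping.lookup p m) * (\<Prod>i\<in>Poly_Mapping.keys m. s i ^ Poly_Mapping.lookup m i))"

context
  fixes h :: "complex \<Rightarrow> 'b::comm_ring_1" and s :: "'v \<Rightarrow> 'b"
  assumes h: "ring_hom h"
begin

lemma psubst_add: "psubst h s (p + q) = psubst h s p + psubst h s q"
proof -
  let ?M = "Poly_Mapping.keys p \<union> Poly_Mapping.keys q"
  have *: "psubst h s r = (\<Sum>m\<in>?M. h (Poly_Mapping.lookup r m) * (\<Prod>i\<in>Poly_Mapping.keys m. s i ^ Poly_Mapping.lookup m i))"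
    if "Poly_Mapping.keys r \<subseteq> ?M" for r
    unfolding psubst_def using that
    by (intro sum.mono_neutral_left) (auto simp: in_keys_iff ring_homD[OF h])
  show ?thesis
    using keys_add[of p q]
    by (simp add: * lookup_add ring_homD[OF h] algebra_simps sum.distrib)
qed

lemma psubst_single:
  "psubst h s (Poly_Mapping.single m c) = h c * (\<Prod>i\<in>Poly_Mapping.keys m. s i ^ Poly_Mapping.lookup m i)"
  by (simp add: psubst_def ring_homD[OF h])

lemma psubst_sum: "psubst h s (\<Sum>i\<in>I. f i) = (\<Sum>i\<in>I. psubst h s (f i))"
proof -
  have "psubst h s 0 = 0" by (simp add: psubst_def)
  then show ?thesis
    by (induction I rule: infinite_finite_induct) (simp_all add: psubst_add)
qed

lemma psubst_mult: "psubst h s (p * q) = psubst h s p * psubst h s q"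
proof -
  have mon: "(\<Prod>i\<in>Poly_Mapping.keys (m + n). s i ^ Poly_Mapping.lookup (m + n) i) =
     (\<Prod>i\<in>Poly_Mapping.keys m. s i ^ Poly_Mapping.lookup m i) * (\<Prod>i\<in>Poly_Mapping.keys n. s i ^ Poly_Mapping.lookup n i)"
    for m n :: "'v \<Rightarrow>\<^sub>0 nat"
  proof -
    let ?M = "Poly_Mapping.keys m \<union> Poly_Mapping.keys n"
    have *: "(\<Prod>i\<in>Poly_Mapping.keys r. s i ^ Poly_Mapping.lookup r i) = (\<Prod>i\<in>?M. s i ^ Poly_Mapping.lookup r i)"
      if "Poly_Mapping.keys r \<subseteq> ?M" for r :: "'v \<Rightarrow>\<^sub>0 nat"
      using that by (intro prod.mono_neutral_left) (auto simp: in_keys_iff)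
    show ?thesis
      unfolding *[OF keys_add] *[OF Un_upper1] *[OF Un_upper2]
      by (simp add: lookup_add power_add prod.distrib)
  qed
  have ss: "psubst h s (Poly_Mapping.single m a * Poly_Mapping.single n b) =
     psubst h s (Poly_Mapping.single m a) * psubst h s (Poly_Mapping.single n b)" for m n a b
    by (simp add: mult_single psubst_single mon ring_homD[OF h] algebra_simps)
  show ?thesis
    by (subst (1 2) cpoly_decomp[of p], subst (1 2) cpoly_decomp[of q])
       (simp only: sum_product psubst_sum ss)
qed

lemma psubst_Cst [simp]: "psubst h s (Cst c) = h c"
  by (simp add: Cst_def psubst_single)

lemma psubst_Var [simp]: "psubst h s (Var i) = s i"
  by (simp add: Var_def psubst_single ring_homD[OF h])

lemma ring_hom_psubst: "ring_hom (psubst h s)"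
  using psubst_Cst[of 1] by (simp add: ring_hom_def psubst_add psubst_mult ring_homD[OF h] del: psubst_Cst)

end

text \<open>Homogeneity is read off from the substitution \<open>X\<^sub>i \<mapsto> X\<^sub>i t\<close>: it turns a polynomial of degree
  \<open>d\<close> into a monomial in \<open>t\<close>, and factors of monomials over a domain are monomials.\<close>

definition grading :: "'v cpoly \<Rightarrow> 'v cpoly poly" where
  "grading = psubst (\<lambda>c. [:Cst c:]) (\<lambda>i. monom (Var i) 1)"

lemma ring_hom_const_Cst: "ring_hom (\<lambda>c. [:Cst c:])"
  by (rule ring_hom_comp[OF ring_hom_const_poly ring_hom_Cst])

lemma ring_hom_grading: "ring_hom grading"
  unfolding grading_def by (rule ring_hom_psubst[OF ring_hom_const_Cst])

lemma grading_Cst [simp]: "grading (Cst c) = [:Cst c:]"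
  and grading_Var [simp]: "grading (Var i) = monom (Var i) 1"
  unfolding grading_def by (simp_all add: ring_hom_const_Cst)

lemma poly_grading_1 [simp]: "poly (grading p) 1 = p"
  by (rule ring_hom_eqI[of "\<lambda>p. poly (grading p) 1"])
     (auto intro: ring_hom_comp[OF ring_hom_poly ring_hom_grading] ring_hom_ident simp: poly_monom)

lemma grading_eq_0_iff [simp]: "grading p = 0 \<longleftrightarrow> p = 0"
  using poly_grading_1[of p] ring_homD(4)[OF ring_hom_grading] by (metis poly_0)

text \<open>Unlike \<open>homogeneous\<close>, this also makes sense over infinitely many variables,
  in particular over \<open>nat\<close>.\<close>

definition hom_deg :: "nat \<Rightarrow> 'v cpoly \<Rightarrow> bool" where
  "hom_deg d p \<longleftrightarrow> grading p = monom p d"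

lemma hom_deg_0 [simp]: "hom_deg d 0"
  by (simp add: hom_deg_def ring_homD[OF ring_hom_grading])

lemma hom_deg_Cst [simp]: "hom_deg 0 (Cst c)"
  by (simp add: hom_deg_def monom_0)

lemma hom_deg_Var [simp]: "hom_deg 1 (Var i)"
  by (simp add: hom_deg_def)

lemma hom_deg_add: "hom_deg d p \<Longrightarrow> hom_deg d q \<Longrightarrow> hom_deg d (p + q)"
  by (simp add: hom_deg_def ring_homD[OF ring_hom_grading] add_monom)

lemma hom_deg_diff: "hom_deg d p \<Longrightarrow> hom_deg d q \<Longrightarrow> hom_deg d (p - q)"
  by (simp add: hom_deg_def ring_homD[OF ring_hom_grading] diff_monom)

lemma hom_deg_mult: "hom_deg d p \<Longrightarrow> hom_deg e q \<Longrightarrow> hom_deg (d + e) (p * q)"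
  by (simp add: hom_deg_def ring_homD[OF ring_hom_grading] mult_monom)

lemma hom_deg_scale: "hom_deg d p \<Longrightarrow> hom_deg d (Cst c * p)"
  using hom_deg_mult[OF hom_deg_Cst, of d p c] by simp

lemma hom_deg_power2: "hom_deg 1 p \<Longrightarrow> hom_deg 2 (p\<^sup>2)"
  using hom_deg_mult[of 1 p 1 p] by (simp add: power2_eq_square numeral_2_eq_2)

lemma hom_deg_unique: "hom_deg d p \<Longrightarrow> hom_deg e p \<Longrightarrow> p \<noteq> 0 \<Longrightarrow> d = e"
  by (metis hom_deg_def degree_monom_eq)

text \<open>\<open>grading\<close> commutes with \<open>f\<close>, applied coefficientwise, since
  both composites are homomorphisms that agree on constants and variables.\<close>

lemma hom_deg_hom:
  fixes f :: "'v cpoly \<Rightarrow> 'w cpoly"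
  assumes f: "ring_hom f" "\<And>c. f (Cst c) = Cst c" "\<And>i. hom_deg 1 (f (Var i))" and p: "hom_deg d p"
  shows "hom_deg d (f p)"
proof -
  have f0: "f 0 = 0" by (rule ring_homD[OF f(1)])
  have "grading (f p) = map_poly f (grading p)"
  proof (rule ring_hom_eqI[of "\<lambda>p. grading (f p)" "\<lambda>p. map_poly f (grading p)"])
    show "ring_hom (\<lambda>p. grading (f p))"
      by (rule ring_hom_comp[OF ring_hom_grading f(1)])
    show "ring_hom (\<lambda>p. map_poly f (grading p))"
      by (rule ring_hom_comp[OF ring_hom_map_poly[OF f(1)] ring_hom_grading])
    show "grading (f (Cst c)) = map_poly f (grading (Cst c))" for c
      by (simp add: f(2) map_poly_pCons f0)
    show "grading (f (Var i)) = map_poly f (grading (Var i))" for i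
      using f(3)[of i] by (simp add: hom_deg_def map_poly_monom f0)
  qed
  then show ?thesis
    using p by (simp add: hom_deg_def map_poly_monom f0)
qed

lemma grading_single:
  "grading (Poly_Mapping.single m c) =
    monom (Poly_Mapping.single m c) (\<Sum>i\<in>Poly_Mapping.keys m. Poly_Mapping.lookup m i)"
proof -
  have *: "(\<Prod>i\<in>I. monom (Var i :: 'v cpoly) 1 ^ f i) = monom (\<Prod>i\<in>I. Var i ^ f i) (\<Sum>i\<in>I. f i)"
    for I :: "'v set" and f
    by (induction I rule: infinite_finite_induct) (simp_all add: monom_power mult_monom one_pCons monom_0)
  show ?thesis
    by (subst (1 2) monom_conv_Var_prod[OF finite_keys order_refl])
       (simp add: ring_homD[OF ring_hom_grading] ring_hom_prod[OF ring_hom_grading] *[simplified] smult_monom)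
qed

text \<open>The coefficients in \<open>t\<close> are the homogeneous components of \<open>p\<close>;
  this ties \<open>hom_deg\<close> to the degrees of the occurring monomials.\<close>

lemma lookup_coeff_grading:
  "Poly_Mapping.lookup (coeff (grading p) d) m =
    (if (\<Sum>i\<in>Poly_Mapping.keys m. Poly_Mapping.lookup m i) = d then Poly_Mapping.lookup p m else 0)"
proof -
  have "grading p = (\<Sum>m\<in>Poly_Mapping.keys p. monom (Poly_Mapping.single m (Poly_Mapping.lookup p m))
      (\<Sum>i\<in>Poly_Mapping.keys m. Poly_Mapping.lookup m i))"
    by (subst cpoly_decomp) (simp only: ring_hom_sum[OF ring_hom_grading] grading_single)
  then have "Poly_Mapping.lookup (coeff (grading p) d) m =
     (\<Sum>n\<in>Poly_Mapping.keys p. if n = m then (if (\<Sum>i\<in>Poly_Mapping.keys m. Poly_Mapping.lookup m i) = d then Poly_Mapping.lookup p m else 0) else 0)"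
    by (simp only: coeff_sum lookup_sum, intro sum.cong refl) (auto simp: lookup_single when_def)
  then show ?thesis
    by (auto simp: sum.delta in_keys_iff)
qed

lemma hom_deg_iff:
  "hom_deg d p \<longleftrightarrow> (\<forall>m\<in>Poly_Mapping.keys p. (\<Sum>i\<in>Poly_Mapping.keys m. Poly_Mapping.lookup m i) = d)"
proof
  assume "hom_deg d p"
  then show "\<forall>m\<in>Poly_Mapping.keys p. (\<Sum>i\<in>Poly_Mapping.keys m. Poly_Mapping.lookup m i) = d"
    using lookup_coeff_grading[of p d] by (metis coeff_monom hom_deg_def in_keys_iff)
next
  assume *: "\<forall>m\<in>Poly_Mapping.keys p. (\<Sum>i\<in>Poly_Mapping.keys m. Poly_Mapping.lookup m i) = d"
  show "hom_deg d p"
    unfolding hom_deg_def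
    by (rule poly_eqI, rule poly_mapping_eqI) (use * in \<open>auto simp: lookup_coeff_grading in_keys_iff\<close>)
qed

lemma hom_deg_0_imp_Cst:
  assumes "hom_deg 0 p"
  shows "\<exists>c. p = Cst c"
proof (intro exI poly_mapping_eqI)
  fix m
  have "m = 0" if "m \<in> Poly_Mapping.keys p"
    using assms that by (auto simp: hom_deg_iff in_keys_iff intro!: poly_mapping_eqI)
  then show "Poly_Mapping.lookup p m = Poly_Mapping.lookup (Cst (Poly_Mapping.lookup p 0)) m"
    by (cases "m = 0") (auto simp: Cst_def lookup_single in_keys_iff)
qed

text \<open>A variable can be split off each monomial of positive degree. Used to verify formulas
  for linear and quadratic forms.\<close>

lemma hom_deg_induct [consumes 1, case_names zero add mult]:
  fixes p :: "'v cpoly"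
  assumes "hom_deg (Suc d) p"
    and "P 0" "\<And>p q. P p \<Longrightarrow> P q \<Longrightarrow> P (p + q)" and mult: "\<And>p i. hom_deg d p \<Longrightarrow> P (Var i * p)"
  shows "P p"
proof -
  have "P (Poly_Mapping.single m c)"
    if "(\<Sum>i\<in>Poly_Mapping.keys m. Poly_Mapping.lookup m i) = Suc d" for m c
  proof -
    from that obtain i where i: "i \<in> Poly_Mapping.keys m"
      by (metis (no_types, lifting) equals0I nat.distinct(1) sum.empty)
    have m: "m = Poly_Mapping.single i 1 + (m - Poly_Mapping.single i 1)"
      using i by (intro poly_mapping_eqI)
        (auto simp: lookup_add lookup_minus lookup_single when_def in_keys_iff)
    define n where "n = m - Poly_Mapping.single i 1"
    have e: "Poly_Mapping.single m c = Var i * Poly_Mapping.single n c"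
      using m by (simp add: Var_def mult_single n_def)
    have g: "grading (Poly_Mapping.single n c) = monom (Poly_Mapping.single n c) (\<Sum>i\<in>Poly_Mapping.keys n. Poly_Mapping.lookup n i)"
      by (rule grading_single)
    \<comment> \<open>The degree of \<open>n\<close> is found by comparing degrees in the
      factorization \<open>e\<close>. Coefficient 1 replaces \<open>c\<close>, which may be 0 and
      would leave the degree undetermined.\<close>
    have "Suc d = 1 + (\<Sum>i\<in>Poly_Mapping.keys n. Poly_Mapping.lookup n i)"
    proof -
      have "hom_deg (Suc d) (Poly_Mapping.single m (1::complex))"
        by (simp add: hom_deg_iff that)
      moreover have "hom_deg (1 + (\<Sum>i\<in>Poly_Mapping.keys n. Poly_Mapping.lookup n i)) (Var i * Poly_Mapping.single n 1)"
        by (intro hom_deg_mult hom_deg_Var) (simp add: hom_deg_iff)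
      moreover have "Poly_Mapping.single m (1::complex) = Var i * Poly_Mapping.single n 1"
        using m by (simp add: Var_def mult_single n_def)
      moreover have "Poly_Mapping.single m (1::complex) \<noteq> 0"
        by (metis lookup_single_eq lookup_zero zero_neq_one)
      ultimately show ?thesis by (metis hom_deg_unique)
    qed
    then have "hom_deg d (Poly_Mapping.single n c)"
      using g by (simp add: hom_deg_def)
    then show ?thesis unfolding e by (rule mult)
  qed
  then have "P (\<Sum>m\<in>M. Poly_Mapping.single m (Poly_Mapping.lookup p m))" if "M \<subseteq> Poly_Mapping.keys p" for M
    using that assms(1)
    by (induction M rule: infinite_finite_induct) (auto intro!: assms(2,3) simp: hom_deg_iff)
  then show ?thesis by (subst cpoly_decomp) simp
qed

subsection \<open>Irreducible polynomials in several variables are prime\<close>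

lemma irreducible_factor_cases:
  fixes f :: "'a::comm_semiring_1"
  assumes "irreducible f" "p dvd f"
  shows "p dvd 1 \<or> f dvd p"
proof -
  obtain z where z: "f = p * z" using assms(2) by (rule dvdE)
  have "f dvd p" if "z dvd 1"
  proof -
    obtain w where "1 = z * w" using \<open>z dvd 1\<close> by (rule dvdE)
    then have "p = f * w" by (simp add: z mult.assoc)
    then show ?thesis by simp
  qed
  moreover have "p dvd 1 \<or> z dvd 1" using assms(1) z by (simp add: irreducible_def)
  ultimately show ?thesis by blast
qed

text \<open>For positive \<open>d\<close> the constant coefficients of \<open>f\<close> and
  \<open>g\<close> multiply to 0, so one factor is divisible by the variable, which is
  cancelled.\<close>

lemma monom_factors:
  fixes f g :: "'a::idom poly"
  assumes "f * g = monom a d" "a \<noteq> 0"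
  shows "\<exists>i j b c. i + j = d \<and> f = monom b i \<and> g = monom c j"
  using assms(1)
proof (induction d arbitrary: f g)
  case 0
  then have "f * g = [:a:]" by (simp add: monom_0)
  moreover from this have "f \<noteq> 0" "g \<noteq> 0" using assms(2) by auto
  ultimately have "degree f + degree g = 0"
    by (metis degree_mult_eq degree_pCons_0)
  then obtain b c where "f = [:b:]" "g = [:c:]"
    by (metis add_is_0 degree_eq_zeroE)
  then show ?case by (metis add_0 monom_0)
next
  case (Suc d)
  from Suc.prems have "coeff f 0 * coeff g 0 = 0"
    by (metis coeff_mult_0 coeff_monom nat.distinct(1))
  moreover have *: "\<exists>i j b c. i + j = Suc d \<and> f = monom b i \<and> g = monom c j"
    if fg: "f * g = monom a (Suc d)" and 0: "coeff f 0 = 0" for f g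
  proof -
    obtain f' where f': "f = pCons 0 f'" by (metis 0 coeff_pCons_0 pCons_cases)
    then have "f' * g = monom a d" using fg by (simp add: monom_Suc)
    from Suc.IH[OF this] obtain i j b c where ij: "i + j = d" "f' = monom b i" "g = monom c j" by blast
    then have "Suc i + j = Suc d" "f = monom b (Suc i)" by (simp_all add: f' monom_Suc)
    then show ?thesis using ij(3) by blast
  qed
  ultimately show ?case
    using *[of f g] *[of g f] Suc.prems by (metis add.commute mult.commute mult_eq_0_iff)
qed

text \<open>The gradings of \<open>p\<close> and \<open>q\<close> are monomials by
  \<open>monom_factors\<close>; evaluation at 1 identifies their coefficients as \<open>p\<close>
  and \<open>q\<close>.\<close>

lemma hom_deg_factors:
  fixes p q :: "'v::linorder cpoly"
  assumes "hom_deg d (p * q)" "p * q \<noteq> 0"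
  shows "\<exists>i j. i + j = d \<and> hom_deg i p \<and> hom_deg j q"
proof -
  have "grading p * grading q = monom (p * q) d"
    using assms by (simp add: hom_deg_def ring_homD[OF ring_hom_grading])
  from monom_factors[OF this assms(2)] obtain i j b c
    where ij: "i + j = d" "grading p = monom b i" "grading q = monom c j" by blast
  moreover from ij have "b = p" "c = q"
    using poly_grading_1[of p] poly_grading_1[of q] by (simp_all add: poly_monom)
  ultimately show ?thesis by (auto simp: hom_deg_def)
qed

text \<open>1 is a form of degree 0, so its factors are forms of degree 0.\<close>

lemma cpoly_unit_iff:
  fixes p :: "'v::linorder cpoly"
  shows "p dvd 1 \<longleftrightarrow> (\<exists>c. c \<noteq> 0 \<and> p = Cst c)"
proof
  assume "p dvd 1"
  then obtain q where q: "1 = p * q" by (rule dvdE)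
  have "hom_deg 0 (p * q)" using hom_deg_Cst[of 1] q by simp
  then have "hom_deg 0 p" using hom_deg_factors[of 0 p q] q by force
  then show "\<exists>c. c \<noteq> 0 \<and> p = Cst c"
    using hom_deg_0_imp_Cst[of p] q by fastforce
qed (auto simp: Cst_dvd_1)

section \<open>Total degree and existence of irreducible factors\<close>

definition total_degree :: "'v cpoly \<Rightarrow> nat" where
  "total_degree p = degree (grading p)"

lemma total_degree_mult:
  fixes p q :: "'v::linorder cpoly"
  assumes "p \<noteq> 0" "q \<noteq> 0"
  shows "total_degree (p * q) = total_degree p + total_degree q"
  using assms by (simp add: total_degree_def ring_homD[OF ring_hom_grading] degree_mult_eq)

lemma total_degree_0_imp_Cst:
  assumes "total_degree p = 0"
  shows "\<exists>c. p = Cst c"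
proof -
  from assms obtain a where "grading p = [:a:]"
    unfolding total_degree_def by (rule degree_eq_zeroE)
  then have "hom_deg 0 p"
    using poly_grading_1[of p] by (simp add: hom_deg_def monom_0)
  then show ?thesis by (rule hom_deg_0_imp_Cst)
qed

lemma total_degree_pos:
  fixes p :: "'v::linorder cpoly"
  assumes "p \<noteq> 0" "\<not> p dvd 1"
  shows "total_degree p > 0"
proof (rule ccontr)
  assume "\<not> total_degree p > 0"
  then obtain c where "p = Cst c" using total_degree_0_imp_Cst by blast
  then show False using assms by (auto simp: cpoly_unit_iff)
qed

lemma irreducible_factor_exists:
  fixes p :: "'v::linorder cpoly"
  assumes "p \<noteq> 0" "\<not> p dvd 1"
  shows "\<exists>q. irreducible q \<and> q dvd p"
  using assms
proof (induction "total_degree p" arbitrary: p rule: less_induct)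
  case less
  show ?case
  proof (cases "irreducible p")
    case False
    then obtain a b where ab: "p = a * b" "\<not> a dvd 1" "\<not> b dvd 1"
      using less.prems by (auto simp: irreducible_def)
    with less.prems have "a \<noteq> 0" "b \<noteq> 0" by auto
    moreover have "total_degree b \<noteq> 0"
      using ab(3) \<open>b \<noteq> 0\<close> total_degree_pos[of b] by simp
    ultimately show ?thesis
      using less.hyps[of a] ab by (auto simp: total_degree_mult)
  qed auto
qed

text \<open>The subring on the variables in \<open>S\<close>, kept inside the full type so that
  induction on the number of variables never changes the ring.\<close>

inductive_set polys_in :: "'v set \<Rightarrow> 'v cpoly set" for S where
  Cst: "Cst c \<in> polys_in S"
| Var: "i \<in> S \<Longrightarrow> Var i \<in> polys_in S"
| add: "p \<in> polys_in S \<Longrightarrow> q \<in> polys_in S \<Longrightarrow> p + q \<in> polys_in S"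
| mult: "p \<in> polys_in S \<Longrightarrow> q \<in> polys_in S \<Longrightarrow> p * q \<in> polys_in S"

lemma polys_in_0: "0 \<in> polys_in S"
  using polys_in.Cst[of 0] by simp

lemma polys_in_diff: "p \<in> polys_in S \<Longrightarrow> q \<in> polys_in S \<Longrightarrow> p - q \<in> polys_in S"
  using polys_in.add[OF _ polys_in.mult[OF polys_in.Cst[of "-1"]], of p S q] by (simp add: Cst_arith)

lemma polys_in_power: "p \<in> polys_in S \<Longrightarrow> p ^ n \<in> polys_in S"
  using polys_in.Cst[of 1] by (induction n) (auto intro: polys_in.mult)

lemma polys_in_sum: "(\<And>i. i \<in> I \<Longrightarrow> f i \<in> polys_in S) \<Longrightarrow> (\<Sum>i\<in>I. f i) \<in> polys_in S"
  by (induction I rule: infinite_finite_induct) (auto intro: polys_in.add polys_in_0)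

lemma polys_in_mono: "S \<subseteq> T \<Longrightarrow> polys_in S \<subseteq> polys_in T"
proof
  fix p assume "S \<subseteq> T" "p \<in> polys_in S"
  from this(2) this(1) show "p \<in> polys_in T"
    by (induction rule: polys_in.induct) (auto intro: polys_in.intros)
qed

lemma finite_polys_in: "\<exists>S. finite S \<and> p \<in> polys_in S"
proof (induction p rule: cpoly_induct)
  case (add p q)
  then obtain S T where "finite S" "p \<in> polys_in S" "finite T" "q \<in> polys_in T" by auto
  then show ?case using polys_in_mono[of S "S \<union> T"] polys_in_mono[of T "S \<union> T"]
    by (intro exI[of _ "S \<union> T"]) (auto intro: polys_in.intros)
next
  case (mult p q)
  then obtain S T where "finite S" "p \<in> polys_in S" "finite T" "q \<in> polys_in T" by auto
  then show ?case using polys_in_mono[of S "S \<union> T"] polys_in_mono[of T "S \<union> T"]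
    by (intro exI[of _ "S \<union> T"]) (auto intro: polys_in.intros)
qed (auto intro: polys_in.intros)

lemma polys_in_empty: "p \<in> polys_in {} \<Longrightarrow> \<exists>c. p = Cst c"
proof (induction rule: polys_in.induct)
  case (add p q)
  then show ?case by (metis Cst_arith(2))
next
  case (mult p q)
  then show ?case by (metis Cst_arith(3))
qed auto

text \<open>Reads \<open>p\<close> as a polynomial in \<open>Var x\<close>. The coefficients remain
  in the full ring; \<open>coeff_univ_in\<close> records that they are free of
  \<open>x\<close>.\<close>

definition univ :: "'v \<Rightarrow> 'v cpoly \<Rightarrow> 'v cpoly poly" where
  "univ x = psubst (\<lambda>c. [:Cst c:]) (\<lambda>i. if i = x then [:0, 1:] else [:Var i:])"

lemma ring_hom_univ: "ring_hom (univ x)"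
  unfolding univ_def by (rule ring_hom_psubst[OF ring_hom_const_Cst])

lemma univ_Cst [simp]: "univ x (Cst c) = [:Cst c:]"
  and univ_Var: "univ x (Var i) = (if i = x then [:0, 1:] else [:Var i:])"
  unfolding univ_def by (simp_all add: ring_hom_const_Cst)

lemma poly_univ [simp]: "poly (univ x p) (Var x) = p"
  by (induction p rule: cpoly_induct) (simp_all add: univ_Var ring_homD[OF ring_hom_univ])

lemma univ_eq_0_iff [simp]: "univ x p = 0 \<longleftrightarrow> p = 0"
  using poly_univ[of x p] ring_homD(4)[OF ring_hom_univ] by (metis poly_0)

lemma univ_const: "p \<in> polys_in S \<Longrightarrow> x \<notin> S \<Longrightarrow> univ x p = [:p:]"
proof (induction rule: polys_in.induct)
  case (Var i)
  then show ?case by (auto simp: univ_Var)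
qed (simp_all add: ring_homD[OF ring_hom_univ])

lemma coeff_univ_in: "p \<in> polys_in (insert x S) \<Longrightarrow> coeff (univ x p) n \<in> polys_in S"
proof (induction arbitrary: n rule: polys_in.induct)
  case (Cst c)
  then show ?case by (auto simp: coeff_pCons polys_in_0 split: nat.splits intro: polys_in.intros)
next
  case (Var i)
  then show ?case using polys_in.Cst[of 1]
    by (auto simp: coeff_pCons polys_in_0 univ_Var split: nat.splits intro: polys_in.intros)
qed (auto simp: ring_homD[OF ring_hom_univ] coeff_mult intro!: polys_in_sum intro: polys_in.intros)

lemma polys_in_univ_degree_0:
  assumes "p \<in> polys_in (insert x S)" "degree (univ x p) = 0"
  shows "p \<in> polys_in S"
proof -
  obtain a where a: "univ x p = [:a:]" using assms(2) by (rule degree_eq_zeroE)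
  then have "a = p" using poly_univ[of x p] by simp
  then show ?thesis using coeff_univ_in[OF assms(1), of 0] a by simp
qed

lemma polys_in_factor:
  fixes p q :: "'v::linorder cpoly"
  assumes "p * q \<in> polys_in S" "p * q \<noteq> 0"
  shows "p \<in> polys_in S"
proof -
  obtain T where T: "finite T" "p \<in> polys_in T" using finite_polys_in by auto
  have "p \<in> polys_in (S \<union> T)" using T polys_in_mono[of T "S \<union> T"] by auto
  with T(1) show ?thesis
  proof (induction T rule: finite_induct)
    case (insert x T)
    show ?case
    proof (cases "x \<in> S")
      case False
      have "univ x p * univ x q = [:p * q:]"
        using univ_const[OF assms(1) False] by (simp add: ring_homD[OF ring_hom_univ])
      then have "degree (univ x p) = 0"
        using assms(2) degree_mult_eq[of "univ x p" "univ x q"] by simp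
      then have "p \<in> polys_in (S \<union> T)"
        using insert.prems polys_in_univ_degree_0[of p x "S \<union> T"] by simp
      then show ?thesis by (rule insert.IH)
    qed (use insert in \<open>simp add: insert_absorb\<close>)
  qed simp
qed

text \<open>Divisibility is that of the full ring; only \<open>g\<close> and \<open>h\<close> are
  confined to \<open>S\<close>, which is what the induction on \<open>S\<close> can control.\<close>

definition prime_in :: "'v set \<Rightarrow> 'v cpoly \<Rightarrow> bool" where
  "prime_in S p \<longleftrightarrow> (\<forall>g\<in>polys_in S. \<forall>h\<in>polys_in S. p dvd g * h \<longrightarrow> p dvd g \<or> p dvd h)"

lemma dvd_iff_dvd_coeffs:
  assumes "p \<in> polys_in S" "x \<notin> S"
  shows "p dvd g \<longleftrightarrow> (\<forall>n. p dvd coeff (univ x g) n)"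
proof
  assume "p dvd g"
  then obtain z where "g = p * z" by (rule dvdE)
  then have "univ x g = smult p (univ x z)"
    by (simp add: ring_homD[OF ring_hom_univ] univ_const[OF assms])
  then show "\<forall>n. p dvd coeff (univ x g) n" by simp
next
  assume "\<forall>n. p dvd coeff (univ x g) n"
  then have "p dvd poly (univ x g) (Var x)"
    by (auto simp: poly_altdef intro!: dvd_sum)
  then show "p dvd g" by simp
qed

text \<open>If \<open>p\<close> divides neither factor, take the first coefficients not divisible by
  \<open>p\<close>, at \<open>i\<close> and \<open>j\<close>. In the coefficient of index
  \<open>i + j\<close> of the product all other terms are divisible by \<open>p\<close>, so
  \<open>p\<close> divides the product of these two, against primality on \<open>S\<close>.\<close>

lemma prime_in_insert:
  assumes p: "p \<in> polys_in S" "prime_in S p" and x: "x \<notin> S"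
  shows "prime_in (insert x S) p"
  unfolding prime_in_def
proof (intro ballI impI, rule ccontr)
  fix g h assume gh: "g \<in> polys_in (insert x S)" "h \<in> polys_in (insert x S)" "p dvd g * h"
    and "\<not> (p dvd g \<or> p dvd h)"
  then have ex: "\<exists>n. \<not> p dvd coeff (univ x g) n" "\<exists>n. \<not> p dvd coeff (univ x h) n"
    using dvd_iff_dvd_coeffs[OF p(1) x, of g] dvd_iff_dvd_coeffs[OF p(1) x, of h] by blast+
  define i where "i = (LEAST n. \<not> p dvd coeff (univ x g) n)"
  define j where "j = (LEAST n. \<not> p dvd coeff (univ x h) n)"
  have i: "\<not> p dvd coeff (univ x g) i" "\<And>n. n < i \<Longrightarrow> p dvd coeff (univ x g) n"
    unfolding i_def using LeastI_ex[OF ex(1)] not_less_Least by auto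
  have j: "\<not> p dvd coeff (univ x h) j" "\<And>n. n < j \<Longrightarrow> p dvd coeff (univ x h) n"
    unfolding j_def using LeastI_ex[OF ex(2)] not_less_Least by auto
  let ?t = "\<lambda>k. coeff (univ x g) k * coeff (univ x h) (i + j - k)"
  have "p dvd coeff (univ x (g * h)) (i + j)"
    using gh(3) dvd_iff_dvd_coeffs[OF p(1) x, of "g * h"] by blast
  then have "p dvd (\<Sum>k\<le>i + j. ?t k)"
    by (simp add: ring_homD[OF ring_hom_univ] coeff_mult)
  also have "(\<Sum>k\<le>i + j. ?t k) = ?t i + (\<Sum>k\<in>{..i + j} - {i}. ?t k)"
    by (subst sum.remove[of _ i]) auto
  finally have "p dvd ?t i + (\<Sum>k\<in>{..i + j} - {i}. ?t k)" .
  moreover have "p dvd (\<Sum>k\<in>{..i + j} - {i}. ?t k)"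
  proof (rule dvd_sum)
    fix k assume "k \<in> {..i + j} - {i}"
    then consider "k < i" | "i + j - k < j" by force
    then show "p dvd ?t k" using i(2) j(2) by cases auto
  qed
  ultimately have "p dvd coeff (univ x g) i * coeff (univ x h) j"
    by (simp add: dvd_add_left_iff)
  then show False
    using p(2) i(1) j(1) coeff_univ_in[OF gh(1)] coeff_univ_in[OF gh(2)]
    unfolding prime_in_def by blast
qed

lemma dvd_imp_degree_univ_le:
  fixes p q :: "'v::linorder cpoly"
  shows "p dvd q \<Longrightarrow> q \<noteq> 0 \<Longrightarrow> degree (univ x p) \<le> degree (univ x q)"
  by (metis ring_hom_dvd[OF ring_hom_univ] dvd_imp_degree_le univ_eq_0_iff)

section \<open>Inductive step: adjoining a variable \<open>x\<close> to \<open>S\<close>, with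
  \<open>irr_prime\<close> as induction hypothesis\<close>

context
  fixes S :: "'v::linorder set" and x :: 'v
  assumes irr_prime: "\<And>f. f \<in> polys_in S \<Longrightarrow> irreducible f \<Longrightarrow> prime_in S f" and x: "x \<notin> S"
begin

lemma irr_prime_insert:
  "f \<in> polys_in S \<Longrightarrow> irreducible f \<Longrightarrow> g \<in> polys_in (insert x S) \<Longrightarrow> h \<in> polys_in (insert x S)
    \<Longrightarrow> f dvd g * h \<Longrightarrow> f dvd g \<or> f dvd h"
  using prime_in_insert[OF _ irr_prime x] unfolding prime_in_def by blast

text \<open>Write \<open>c * h = f * w\<close>. A prime factor \<open>p\<close> of \<open>c\<close>
  divides \<open>f\<close> or \<open>w\<close>. It cannot divide \<open>f\<close>: then
  \<open>f\<close> would divide \<open>p\<close>, which is free of \<open>x\<close>. So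
  \<open>p\<close> is cancelled against \<open>w\<close>, and the total degree of \<open>c\<close>
  drops.\<close>

lemma cancel_const:
  assumes f: "irreducible f" "f \<in> polys_in (insert x S)" "degree (univ x f) > 0"
    and "c \<in> polys_in S" "c \<noteq> 0" "h \<in> polys_in (insert x S)" "f dvd c * h"
  shows "f dvd h"
  using assms(4-7)
proof (induction "total_degree c" arbitrary: c rule: less_induct)
  case less
  consider "h = 0" | "c dvd 1" | "h \<noteq> 0" "\<not> c dvd 1" by blast
  then show ?case
  proof cases
    case 2
    then obtain k where "k \<noteq> 0" "c = Cst k" using cpoly_unit_iff[of c] by blast
    then show ?thesis using less.prems(4) by (metis Cst_cancel(2) dvd_mult)
  next
    case 3
    obtain p where p: "irreducible p" "p dvd c"
      using irreducible_factor_exists[of c] 3 less.prems by blast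
    obtain c' where c': "c = p * c'" using p(2) by (rule dvdE)
    have pS: "p \<in> polys_in S" "c' \<in> polys_in S"
      using less.prems(1,2) polys_in_factor[of p c' S] polys_in_factor[of c' p S] c'
      by (auto simp: mult.commute)
    obtain w where w: "c * h = f * w" using less.prems(4) by (rule dvdE)
    have nz: "c * h \<noteq> 0" using less.prems 3 by simp
    have mono: "polys_in S \<subseteq> polys_in (insert x S)" by (intro polys_in_mono) auto
    have wS: "w \<in> polys_in (insert x S)"
    proof (rule polys_in_factor)
      show "w * f \<in> polys_in (insert x S)"
        unfolding mult.commute[of w] w[symmetric] using less.prems(1,3) mono by (intro polys_in.mult) auto
      show "w * f \<noteq> 0" using nz w by (simp add: mult.commute)
    qed
    have "p dvd f * w" unfolding w[symmetric] c' by (simp add: mult.assoc)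
    then have "p dvd f \<or> p dvd w" by (rule irr_prime_insert[OF pS(1) p(1) f(2) wS])
    moreover have "\<not> p dvd f"
    proof
      assume "p dvd f"
      then have "f dvd p" using irreducible_factor_cases[OF f(1)] p(1) by (auto simp: irreducible_def)
      then have "degree (univ x f) \<le> degree (univ x p)"
        using p(1) by (intro dvd_imp_degree_univ_le) (auto simp: irreducible_def)
      then show False using f(3) univ_const[OF pS(1) x] by simp
    qed
    ultimately obtain w' where "w = p * w'" by (auto elim: dvdE)
    then have "p * (c' * h) = p * (f * w')" using w c' by (simp add: algebra_simps)
    then have "f dvd c' * h" using p(1) by (auto simp: irreducible_def)
    moreover have "c' \<noteq> 0" using c' less.prems(2) by auto
    moreover have "total_degree p \<noteq> 0"
      using p(1) total_degree_pos[of p] by (auto simp: irreducible_def)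
    then have "total_degree c' < total_degree c"
      using p(1) \<open>c' \<noteq> 0\<close> unfolding c' by (subst total_degree_mult) (auto simp: irreducible_def)
    ultimately show ?thesis
      using less.hyps less.prems(3) pS(2) by blast
  qed auto
qed

text \<open>The prime factors of \<open>c\<close> are distributed over the right-hand side: those
  dividing \<open>q\<close> are cancelled, those dividing \<open>d\<close> are collected in
  \<open>e\<close>.\<close>

lemma const_multiple_split:
  assumes "d \<in> polys_in (insert x S)" "q \<in> polys_in (insert x S)" "d \<noteq> 0"
    and "c \<in> polys_in S" "c \<noteq> 0" "c * f = q * d"
  shows "\<exists>e d1. e \<in> polys_in S \<and> e \<noteq> 0 \<and> d = e * d1 \<and> d1 dvd f"
  using assms
proof (induction "total_degree c" arbitrary: c q d rule: less_induct)
  case less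
  show ?case
  proof (cases "c dvd 1")
    case True
    obtain k where "k \<noteq> 0" "c = Cst k" using True cpoly_unit_iff[of c] by blast
    moreover have "d dvd c * f" using less.prems(6) by simp
    ultimately have "d dvd f" by (metis Cst_cancel(2) dvd_mult)
    then show ?thesis using polys_in.Cst[of 1 S] by (intro exI[of _ 1] exI[of _ d]) auto
  next
    case False
    obtain p where p: "irreducible p" "p dvd c"
      using irreducible_factor_exists[of c] False less.prems by blast
    obtain c' where c': "c = p * c'" using p(2) by (rule dvdE)
    have pS: "p \<in> polys_in S" "c' \<in> polys_in S"
      using less.prems(4,5) polys_in_factor[of p c' S] polys_in_factor[of c' p S] c'
      by (auto simp: mult.commute)
    have "c' \<noteq> 0" using c' less.prems(5) by auto
    have "p \<noteq> 0" using p(1) by (auto simp: irreducible_def)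
    have "total_degree p \<noteq> 0"
      using p(1) total_degree_pos[of p] by (auto simp: irreducible_def)
    then have lt: "total_degree c' < total_degree c"
      using \<open>p \<noteq> 0\<close> \<open>c' \<noteq> 0\<close> unfolding c' by (subst total_degree_mult) auto
    have "p dvd q * d" unfolding less.prems(6)[symmetric] c' by (simp add: mult.assoc)
    then consider "p dvd q" | "p dvd d"
      using irr_prime_insert[OF pS(1) p(1) less.prems(2,1)] by blast
    then show ?thesis
    proof cases
      case 1
      then obtain q' where q': "q = p * q'" by (rule dvdE)
      have "p * (c' * f) = p * (q' * d)" using less.prems(6) c' q' by (simp add: algebra_simps)
      then have eq: "c' * f = q' * d" using \<open>p \<noteq> 0\<close> by auto
      have "q' \<in> polys_in (insert x S)"
        using q' less.prems(2) polys_in_factor[of q' p] polys_in_0 by (cases "q' = 0") (auto simp: mult.commute \<open>p \<noteq> 0\<close>)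
      from less.hyps[OF lt less.prems(1) this less.prems(3) pS(2) \<open>c' \<noteq> 0\<close> eq] show ?thesis .
    next
      case 2
      then obtain d' where d': "d = p * d'" by (rule dvdE)
      have "p * (c' * f) = p * (q * d')" using less.prems(6) c' d' by (simp add: algebra_simps)
      then have eq: "c' * f = q * d'" using \<open>p \<noteq> 0\<close> by auto
      have "d' \<in> polys_in (insert x S)" "d' \<noteq> 0"
        using d' less.prems(1,3) polys_in_factor[of d' p] by (auto simp: mult.commute)
      from less.hyps[OF lt this(1) less.prems(2) this(2) pS(2) \<open>c' \<noteq> 0\<close> eq]
      obtain e d1 where "e \<in> polys_in S" "e \<noteq> 0" "d' = e * d1" "d1 dvd f" by blast
      then show ?thesis using pS \<open>p \<noteq> 0\<close> d'
        by (intro exI[of _ "p * e"] exI[of _ d1]) (auto intro: polys_in.mult simp: mult.assoc)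
    qed
  qed
qed

text \<open>Gauss's lemma without fractions: an element \<open>d\<close> of least degree in \<open>x\<close> in the ideal \<open>(f, g)\<close>
  divides every element of the ideal up to a factor free of \<open>x\<close>.\<close>
lemma irreducible_imp_prime_in_insert:
  assumes f: "f \<in> polys_in (insert x S)" "irreducible f"
  shows "prime_in (insert x S) f"
proof (cases "degree (univ x f) = 0")
  case True
  then have "f \<in> polys_in S" by (rule polys_in_univ_degree_0[OF f(1)])
  then show ?thesis by (intro prime_in_insert irr_prime f(2) x)
next
  case False
  let ?R = "polys_in (insert x S)"
  have mono: "polys_in S \<subseteq> ?R" by (intro polys_in_mono) auto
  have f0: "f \<noteq> 0" using f(2) by (auto simp: irreducible_def)
  show ?thesis
    unfolding prime_in_def
  proof (intro ballI impI)
    fix g h assume gR: "g \<in> ?R" and hR: "h \<in> ?R" and fgh: "f dvd g * h"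
    define I where "I = {u * f + v * g |u v. u \<in> ?R \<and> v \<in> ?R}"
    have IR: "I \<subseteq> ?R" unfolding I_def using f(1) gR by (auto intro!: polys_in.add polys_in.mult)
    have "f \<in> I" "g \<in> I" unfolding I_def using polys_in_0 polys_in.Cst[of 1 "insert x S"] by force+
    have comb: "a * s - b * t \<in> I" if st: "s \<in> I" "t \<in> I" and ab: "a \<in> ?R" "b \<in> ?R" for a b s t
    proof -
      from st obtain u v u' v' where *: "s = u * f + v * g" "t = u' * f + v' * g"
          "u \<in> ?R" "v \<in> ?R" "u' \<in> ?R" "v' \<in> ?R"
        unfolding I_def by blast
      then have "a * s - b * t = (a * u - b * u') * f + (a * v - b * v') * g" by (simp add: algebra_simps)
      then show ?thesis unfolding I_def using * ab by (blast intro: polys_in_diff polys_in.mult)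
    qed
    have "\<exists>d. d \<in> I \<and> d \<noteq> 0" using \<open>f \<in> I\<close> f0 by blast
    then obtain d0 where "d0 \<in> I \<and> d0 \<noteq> 0" ..
    from ex_has_least_nat[of "\<lambda>d. d \<in> I \<and> d \<noteq> 0", OF this, of "\<lambda>d. degree (univ x d)"]
    obtain d where d: "d \<in> I" "d \<noteq> 0" and dmin: "\<And>t. t \<in> I \<Longrightarrow> t \<noteq> 0 \<Longrightarrow> degree (univ x d) \<le> degree (univ x t)"
      by auto
    have dR: "d \<in> ?R" using d IR by auto
    have pdiv: "\<exists>c q. c \<in> polys_in S \<and> c \<noteq> 0 \<and> q \<in> ?R \<and> c * t = q * d" if "t \<in> I" for t
      using that
    proof (induction "degree (univ x t)" arbitrary: t rule: less_induct)
      case less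
      show ?case
      proof (cases "t = 0")
        case True
        then show ?thesis using polys_in.Cst[of 1 S] polys_in_0 by (intro exI[of _ 1] exI[of _ 0]) auto
      next
        case False
        define a where "a = lead_coeff (univ x d)"
        define e where "e = lead_coeff (univ x t)"
        define k where "k = degree (univ x t) - degree (univ x d)"
        have k: "degree (univ x t) = k + degree (univ x d)" using dmin[OF less.prems False] by (simp add: k_def)
        have a: "a \<in> polys_in S" "a \<noteq> 0" and e: "e \<in> polys_in S" "e \<noteq> 0"
          unfolding a_def e_def using dR d(2) less.prems IR False by (auto intro!: coeff_univ_in)
        have VR: "Var x ^ k \<in> ?R" by (intro polys_in_power polys_in.Var) auto
        \<comment> \<open>Pseudo-division: multiplying \<open>t\<close> by the leading coefficient
          of \<open>d\<close> lets the leading terms cancel without fractions.\<close>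
        define t' where "t' = a * t - (e * Var x ^ k) * d"
        have t'I: "t' \<in> I" unfolding t'_def using a e mono VR less.prems d
          by (intro comb) (auto intro: polys_in.mult)
        have V: "univ x (Var x ^ k) = monom 1 k"
          by (simp add: ring_homD(7)[OF ring_hom_univ] univ_Var monom_altdef)
        have U: "univ x t' = smult a (univ x t) - monom e k * univ x d"
          unfolding t'_def using a e
          by (simp add: ring_homD(3,6)[OF ring_hom_univ] V univ_const[OF _ x] smult_monom)
        have sm: "degree (smult a (univ x t)) = k + degree (univ x d)" using k a by simp
        have mm: "degree (monom e k * univ x d) = k + degree (univ x d)"
          using e d(2) by (subst degree_mult_eq) (auto simp: degree_monom_eq)
        have "coeff (univ x t') (k + degree (univ x d)) = 0"
          unfolding U using k by (simp add: coeff_monom_mult a_def e_def)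
        moreover have "degree (univ x t') \<le> k + degree (univ x d)"
          unfolding U using sm mm by (metis degree_diff_le order_refl)
        ultimately have t': "t' = 0 \<or> degree (univ x t') < degree (univ x t)"
          using k by (metis le_neq_implies_less leading_coeff_0_iff univ_eq_0_iff)
        have "\<exists>c q. c \<in> polys_in S \<and> c \<noteq> 0 \<and> q \<in> ?R \<and> c * t' = q * d"
        proof (cases "t' = 0")
          case True
          then show ?thesis using polys_in.Cst[of 1 S] polys_in_0 by (intro exI[of _ 1] exI[of _ 0]) auto
        qed (use t' less.hyps t'I in blast)
        then obtain c q where cq: "c \<in> polys_in S" "c \<noteq> 0" "q \<in> ?R" "c * t' = q * d" by blast
        then have "(c * a) * t = (q + c * (e * Var x ^ k)) * d" by (simp add: t'_def algebra_simps)
        moreover have "c * a \<in> polys_in S" "c * a \<noteq> 0" "q + c * (e * Var x ^ k) \<in> ?R"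
          using cq a e VR mono by (auto intro!: polys_in.mult polys_in.add)
        ultimately show ?thesis by blast
      qed
    qed
    show "f dvd g \<or> f dvd h"
    \<comment> \<open>If \<open>d\<close> is free of \<open>x\<close>, then \<open>d * h\<close> is
      a combination of \<open>f\<close> and \<open>g * h\<close>, and \<open>d\<close> can be
      cancelled. Otherwise the part \<open>d1\<close> of \<open>d\<close> is a nonunit dividing
      \<open>f\<close>, hence associated to \<open>f\<close>, so \<open>f\<close> divides
      \<open>d\<close> and thereby \<open>g\<close> up to a factor free of \<open>x\<close>.\<close>
    proof (cases "degree (univ x d) = 0")
      case True
      then have dS: "d \<in> polys_in S" by (rule polys_in_univ_degree_0[OF dR])
      obtain u v where uv: "d = u * f + v * g" using d(1) unfolding I_def by blast
      have "d * h = f * (u * h) + v * (g * h)" by (simp add: uv algebra_simps)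
      then have "f dvd d * h" using fgh by simp
      then show ?thesis using cancel_const[OF f(2,1) _ dS d(2) hR] False by simp
    next
      case dpos: False
      obtain c q where cq: "c \<in> polys_in S" "c \<noteq> 0" "q \<in> ?R" "c * f = q * d"
        using pdiv[OF \<open>f \<in> I\<close>] by blast
      obtain e d1 where e: "e \<in> polys_in S" "e \<noteq> 0" "d = e * d1" "d1 dvd f"
        using const_multiple_split[OF dR cq(3) d(2) cq(1,2,4)] by blast
      have "\<not> d1 dvd 1"
      proof
        assume "d1 dvd 1"
        then have "d1 \<in> polys_in S" by (auto simp: cpoly_unit_iff intro: polys_in.Cst)
        then have "d \<in> polys_in S" using e by (auto intro: polys_in.mult)
        then show False using dpos univ_const[OF _ x] by simp
      qed
      then have "f dvd d1" using irreducible_factor_cases[OF f(2) e(4)] by blast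
      then have "f dvd d" using e(3) by simp
      obtain c' q' where cq': "c' \<in> polys_in S" "c' \<noteq> 0" "q' \<in> ?R" "c' * g = q' * d"
        using pdiv[OF \<open>g \<in> I\<close>] by blast
      then have "f dvd c' * g" using \<open>f dvd d\<close> by simp
      then show ?thesis using cancel_const[OF f(2,1) _ cq'(1,2) gR] False by simp
    qed
  qed
qed

end

lemma irreducible_imp_prime_in:
  fixes S :: "'v::linorder set"
  assumes "finite S" "f \<in> polys_in S" "irreducible f"
  shows "prime_in S f"
  using assms
proof (induction S arbitrary: f rule: finite_induct)
  case empty
  then obtain c where c: "f = Cst c" using polys_in_empty by blast
  then show ?case using empty Cst_dvd_1[of c] by (cases "c = 0") (auto simp: irreducible_def)
next
  case (insert x S)
  then show ?case by (intro irreducible_imp_prime_in_insert) auto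
qed

text \<open>\<open>f\<close>, \<open>g\<close> and \<open>h\<close> together involve finitely many
  variables, so the finite case applies.\<close>

lemma cpoly_irreducible_imp_prime_elem:
  fixes f :: "'v::linorder cpoly"
  assumes "irreducible f"
  shows "prime_elem f"
proof (rule prime_elemI)
  fix g h assume dvd: "f dvd g * h"
  obtain S1 S2 S3 where S: "finite S1" "f \<in> polys_in S1" "finite S2" "g \<in> polys_in S2" "finite S3" "h \<in> polys_in S3"
    using finite_polys_in by metis
  let ?S = "S1 \<union> S2 \<union> S3"
  have "f \<in> polys_in ?S" "g \<in> polys_in ?S" "h \<in> polys_in ?S"
    using S polys_in_mono[of S1 ?S] polys_in_mono[of S2 ?S] polys_in_mono[of S3 ?S] by auto
  then show "f dvd g \<or> f dvd h"
    using irreducible_imp_prime_in[of ?S f] S assms dvd unfolding prime_in_def by blast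
qed (use assms in \<open>auto simp: irreducible_def\<close>)

subsection \<open>Linear and quadratic forms\<close>

lemma hom_deg_quotient:
  fixes p q :: "'v::linorder cpoly"
  assumes "hom_deg (i + j) (p * q)" "hom_deg i p" "p \<noteq> 0"
  shows "hom_deg j q"
proof (cases "q = 0")
  case False
  then obtain i' j' where "i' + j' = i + j" "hom_deg i' p" "hom_deg j' q"
    using hom_deg_factors[OF assms(1)] assms(3) by auto
  then show ?thesis using hom_deg_unique[OF assms(2) _ assms(3), of i'] by auto
qed simp

lemma hom_deg_same_dvd:
  fixes p q :: "'v::linorder cpoly"
  assumes "hom_deg d p" "hom_deg d q" "p dvd q" "q \<noteq> 0"
  shows "\<exists>c. c \<noteq> 0 \<and> q = Cst c * p"
proof -
  obtain k where k: "q = p * k" using assms(3) by (rule dvdE)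
  have "hom_deg 0 k" by (rule hom_deg_quotient[of d 0 p]) (use assms k in auto)
  then obtain c where "k = Cst c" using hom_deg_0_imp_Cst by blast
  then show ?thesis using k assms(4) by (auto simp: mult.commute intro!: exI[of _ c])
qed

lemma hom_deg_dvd_le:
  fixes p q :: "'v::linorder cpoly"
  assumes "hom_deg d p" "hom_deg e q" "p dvd q" "q \<noteq> 0"
  shows "d \<le> e"
proof -
  obtain k where k: "q = p * k" using assms(3) by (rule dvdE)
  then obtain i j where "i + j = e" "hom_deg i p" using hom_deg_factors[of e p k] assms by auto
  then show ?thesis using hom_deg_unique[OF assms(1), of i] k assms(4) by auto
qed

lemma hom_deg_not_unit:
  fixes p :: "'v::linorder cpoly"
  assumes "hom_deg d p" "d > 0"
  shows "\<not> p dvd 1"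
  using hom_deg_dvd_le[OF assms(1) hom_deg_Cst[of 1]] assms(2) by auto

lemma reducible_hom_deg:
  fixes p :: "'v::linorder cpoly"
  assumes "hom_deg d p" "p \<noteq> 0" "d > 0" "\<not> irreducible p"
  shows "\<exists>i j q r. p = q * r \<and> hom_deg i q \<and> hom_deg j r \<and> i > 0 \<and> j > 0 \<and> i + j = d"
proof -
  have "\<not> p dvd 1" by (rule hom_deg_not_unit[OF assms(1,3)])
  then obtain q r where qr: "p = q * r" "\<not> q dvd 1" "\<not> r dvd 1"
    using assms by (auto simp: irreducible_def)
  then obtain i j where ij: "i + j = d" "hom_deg i q" "hom_deg j r"
    using hom_deg_factors[of d q r] assms by auto
  have unit: "s dvd 1" if "hom_deg 0 s" "s \<noteq> 0" for s :: "'v cpoly"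
    using that hom_deg_0_imp_Cst[of s] Cst_dvd_1 by auto
  have "i \<noteq> 0" using unit[of q] qr ij assms(2) by (cases i) auto
  moreover have "j \<noteq> 0" using unit[of r] qr ij assms(2) by (cases j) auto
  ultimately have "i > 0" "j > 0" by simp_all
  then show ?thesis using qr ij by blast
qed

text \<open>Solve \<open>l = 0\<close> for a variable \<open>X_i\<close> occurring in
  \<open>l\<close> with coefficient \<open>a\<close>, that is, substitute \<open>X_i - l / a\<close>
  for it. The image of \<open>\<sigma>\<close> is a model of the quotient by \<open>l\<close> inside
  the same ring, so computations modulo \<open>l\<close> become equations under
  \<open>\<sigma>\<close>.\<close>

lemma linear_retraction:
  fixes l :: "'v cpoly"
  assumes l: "hom_deg 1 l" "l \<noteq> 0"
  shows "\<exists>\<sigma>. ring_hom \<sigma> \<and> \<sigma> l = 0 \<and> (\<forall>c. \<sigma> (Cst c) = Cst c) \<and> (\<forall>p. l dvd p - \<sigma> p)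
     \<and> (\<forall>d p. hom_deg d p \<longrightarrow> hom_deg d (\<sigma> p))"
proof -
  obtain m where m: "m \<in> Poly_Mapping.keys l" using l(2) by fastforce
  then have "(\<Sum>i\<in>Poly_Mapping.keys m. Poly_Mapping.lookup m i) = Suc 0"
    using l(1) by (simp add: hom_deg_iff)
  then obtain i where i: "i \<in> Poly_Mapping.keys m" "Poly_Mapping.lookup m i = 1"
     "\<forall>j\<in>Poly_Mapping.keys m. i \<noteq> j \<longrightarrow> Poly_Mapping.lookup m j = 0"
    by (auto simp: sum_eq_Suc0_iff)
  have mi: "m = Poly_Mapping.single i 1"
    using i by (intro poly_mapping_eqI) (auto simp: lookup_single when_def in_keys_iff)
  define a where "a = Poly_Mapping.lookup l m"
  have a: "a \<noteq> 0" using m by (simp add: a_def in_keys_iff)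
  define \<sigma> where "\<sigma> = psubst Cst (\<lambda>j. if j = i then Var i - Cst (inverse a) * l else Var j)"
  have hom: "ring_hom \<sigma>" unfolding \<sigma>_def by (rule ring_hom_psubst[OF ring_hom_Cst])
  have cst: "\<sigma> (Cst c) = Cst c" for c unfolding \<sigma>_def by (rule psubst_Cst[OF ring_hom_Cst])
  have var: "\<sigma> (Var j) = (if j = i then Var i - Cst (inverse a) * l else Var j)" for j
    unfolding \<sigma>_def by (rule psubst_Var[OF ring_hom_Cst])
  \<comment> \<open>On linear forms \<open>\<sigma>\<close> subtracts the multiple of
    \<open>l\<close> that removes \<open>X_i\<close>; for \<open>l\<close> itself this is all of
    \<open>l\<close>.\<close>
  have lin: "\<sigma> p = p - Cst (Poly_Mapping.lookup p m * inverse a) * l" if "hom_deg (Suc 0) p" for p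
    using that
  proof (induction p rule: hom_deg_induct)
    case (add p q)
    have "\<sigma> (p + q) = \<sigma> p + \<sigma> q" by (rule ring_homD[OF hom])
    then show ?case unfolding add by (simp add: lookup_add Cst_arith algebra_simps)
  next
    case (mult p j)
    then obtain c where c: "p = Cst c" using hom_deg_0_imp_Cst by blast
    have L: "Poly_Mapping.lookup (Var j * Cst c) m = (if i = j then c else 0)"
      unfolding mi Var_def Cst_def
      by (auto simp: mult_single lookup_single when_def)
         (metis lookup_single_eq lookup_single_not_eq nat.distinct(1))
    show ?case unfolding c L by (simp add: ring_homD[OF hom] cst var Cst_arith algebra_simps)
  qed (simp add: ring_homD[OF hom])
  have "\<sigma> l = 0" using lin[of l] l(1) a by (simp add: a_def)
  moreover have "l dvd p - \<sigma> p" for p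
  proof (induction p rule: cpoly_induct)
    case (add p q)
    have "p + q - \<sigma> (p + q) = (p - \<sigma> p) + (q - \<sigma> q)" by (simp add: ring_homD[OF hom])
    then show ?case using dvd_add[OF add] by metis
  next
    case (mult p q)
    have "p * q - \<sigma> (p * q) = (p - \<sigma> p) * q + \<sigma> p * (q - \<sigma> q)"
      by (simp add: ring_homD[OF hom] algebra_simps)
    then show ?case using mult by simp
  qed (auto simp: cst var)
  moreover have "hom_deg d (\<sigma> p)" if "hom_deg d p" for d p
    by (rule hom_deg_hom[OF hom cst _ that])
       (use hom_deg_diff[OF hom_deg_Var hom_deg_scale[OF l(1)]] hom_deg_Var in \<open>auto simp: var\<close>)
  ultimately show ?thesis using hom cst by blast
qed

lemma retraction_dvd_iff:
  assumes "ring_hom \<sigma>" "\<sigma> l = 0" "\<And>p. l dvd p - \<sigma> p"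
  shows "l dvd p \<longleftrightarrow> \<sigma> p = 0"
proof
  assume "l dvd p"
  then obtain k where "p = l * k" by (rule dvdE)
  then show "\<sigma> p = 0" using assms by (simp add: ring_homD)
qed (use assms(3)[of p] in simp)

text \<open>\<open>\<sigma>\<close> maps into a domain and its kernel consists of the multiples of
  \<open>l\<close>.\<close>

lemma linear_prime_elem:
  fixes l :: "'v::linorder cpoly"
  assumes l: "hom_deg 1 l" "l \<noteq> 0"
  shows "prime_elem l"
proof (rule prime_elemI)
  obtain \<sigma> where \<sigma>: "ring_hom \<sigma>" "\<sigma> l = 0" "\<And>p. l dvd p - \<sigma> p"
    using linear_retraction[OF l] by blast
  show "l dvd p \<or> l dvd q" if "l dvd p * q" for p q
    using that by (simp add: retraction_dvd_iff[OF \<sigma>] ring_homD[OF \<sigma>(1)])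
qed (use l hom_deg_not_unit[OF l(1)] in auto)

lemma prime_elem_dvd_prod:
  fixes p :: "'a::comm_semiring_1"
  assumes "prime_elem p" "finite K" "p dvd (\<Prod>k\<in>K. f k)"
  shows "\<exists>k\<in>K. p dvd f k"
  using assms(2,3)
  by (induction K rule: finite_induct) (use assms(1) in \<open>auto simp: prime_elem_def\<close>)

lemma ideal_gen_add: "p \<in> ideal_gen {c, d} \<Longrightarrow> q \<in> ideal_gen {c, d} \<Longrightarrow> p + q \<in> ideal_gen {c, d}"
proof -
  interpret module "(*) :: 'a \<Rightarrow> 'a \<Rightarrow> 'a" by (rule module_times)
  show "p \<in> ideal_gen {c, d} \<Longrightarrow> q \<in> ideal_gen {c, d} \<Longrightarrow> p + q \<in> ideal_gen {c, d}"
    unfolding ideal_gen_def by (rule span_add)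
qed

lemma ideal_gen_mult: "p \<in> ideal_gen {c, d} \<Longrightarrow> r * p \<in> ideal_gen {c, d}"
proof -
  interpret module "(*) :: 'a \<Rightarrow> 'a \<Rightarrow> 'a" by (rule module_times)
  show "p \<in> ideal_gen {c, d} \<Longrightarrow> r * p \<in> ideal_gen {c, d}"
    unfolding ideal_gen_def by (rule span_scale)
qed

section \<open>Evaluation at points and polar forms\<close>

definition peval :: "('v \<Rightarrow> complex) \<Rightarrow> 'v cpoly \<Rightarrow> complex" where
  "peval v = psubst (\<lambda>c. c) v"

lemma ring_hom_peval: "ring_hom (peval v)"
  unfolding peval_def by (rule ring_hom_psubst[OF ring_hom_ident])

lemma peval_Cst [simp]: "peval v (Cst c) = c" and peval_Var [simp]: "peval v (Var i) = v i"
  unfolding peval_def by (simp_all add: ring_hom_ident)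

text \<open>One variable at a time: choose a point where the leading coefficient in \<open>x\<close>
  is nonzero, then a value for \<open>x\<close> outside the roots of the resulting univariate
  polynomial.\<close>

lemma exists_peval_nonzero:
  assumes "p \<noteq> 0"
  shows "\<exists>v. peval v p \<noteq> 0"
proof -
  obtain S where "finite S" "p \<in> polys_in S" using finite_polys_in by blast
  then show ?thesis using assms
  proof (induction S arbitrary: p rule: finite_induct)
    case empty
    then show ?case using polys_in_empty by fastforce
  next
    case (insert x S)
    have "lead_coeff (univ x p) \<in> polys_in S" "lead_coeff (univ x p) \<noteq> 0"
      using insert.prems by (auto intro: coeff_univ_in)
    then obtain v where v: "peval v (lead_coeff (univ x p)) \<noteq> 0" using insert.IH by blast
    define g where "g = map_poly (peval v) (univ x p)"
    have "coeff g (degree (univ x p)) \<noteq> 0"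
      using v by (simp add: g_def coeff_map_poly ring_homD[OF ring_hom_peval])
    then have "g \<noteq> 0" by auto
    then obtain t where t: "poly g t \<noteq> 0" using poly_all_0_iff_0 by blast
    have "peval (v(x := t)) q = poly (map_poly (peval v) (univ x q)) t" for q
    proof (rule ring_hom_eqI[of "peval (v(x := t))" "\<lambda>q. poly (map_poly (peval v) (univ x q)) t"])
      show "ring_hom (\<lambda>q. poly (map_poly (peval v) (univ x q)) t)"
        by (rule ring_hom_comp[OF ring_hom_comp[OF ring_hom_poly ring_hom_map_poly[OF ring_hom_peval]] ring_hom_univ])
    qed (simp_all add: ring_hom_peval map_poly_pCons ring_homD[OF ring_hom_peval] univ_Var)
    then show ?case using t unfolding g_def by metis
  qed
qed

text \<open>Composition with \<open>X \<mapsto> a X + b v\<close>. The multipliers are polynomials: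
  constants give polar forms and restrictions to lines, while \<open>b\<close> and
  \<open>- B1\<close> give the projection from \<open>v\<close>.\<close>

definition shift :: "('v \<Rightarrow> complex) \<Rightarrow> 'v cpoly \<Rightarrow> 'v cpoly \<Rightarrow> 'v cpoly \<Rightarrow> 'v cpoly" where
  "shift v a b = psubst Cst (\<lambda>i. a * Var i + b * Cst (v i))"

definition polar :: "('v \<Rightarrow> complex) \<Rightarrow> 'v cpoly \<Rightarrow> 'v cpoly" where
  "polar v p = shift v 1 1 p - p - Cst (peval v p)"

lemma ring_hom_shift: "ring_hom (shift v a b)"
  unfolding shift_def by (rule ring_hom_psubst[OF ring_hom_Cst])

lemma shift_Cst [simp]: "shift v a b (Cst c) = Cst c"
  and shift_Var [simp]: "shift v a b (Var i) = a * Var i + b * Cst (v i)"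
  unfolding shift_def by (simp_all add: ring_hom_Cst)

lemma polar_diff: "polar v (p - q) = polar v p - polar v q"
  by (simp add: polar_def ring_homD[OF ring_hom_shift] ring_homD[OF ring_hom_peval] Cst_arith)

lemma polar_scale: "polar v (Cst c * p) = Cst c * polar v p"
  by (simp add: polar_def ring_homD[OF ring_hom_shift] ring_homD[OF ring_hom_peval] Cst_arith algebra_simps)

lemma shift_linear:
  assumes "hom_deg 1 p"
  shows "shift v a b p = a * p + b * Cst (peval v p)"
proof -
  have "hom_deg (Suc 0) p" using assms by simp
  then show ?thesis
  proof (induction p rule: hom_deg_induct)
    case (mult p i)
    then obtain c where "p = Cst c" using hom_deg_0_imp_Cst by blast
    then show ?case
      by (simp add: ring_homD[OF ring_hom_shift] ring_homD[OF ring_hom_peval] Cst_arith algebra_simps)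
  qed (simp_all add: ring_homD[OF ring_hom_shift] ring_homD[OF ring_hom_peval] Cst_arith algebra_simps)
qed

text \<open>Expansion of \<open>p\<close> at \<open>a X + b v\<close>. On a product of a variable
  and a linear form, \<open>shift_linear\<close> applies to both factors and the polar form obeys
  the product rule.\<close>

lemma polar_quadratic:
  assumes "hom_deg 2 p"
  shows hom_deg_polar: "hom_deg 1 (polar v p)"
    and shift_quadratic: "shift v a b p = a\<^sup>2 * p + a * b * polar v p + b\<^sup>2 * Cst (peval v p)"
proof -
  have "hom_deg (Suc 1) p" using assms by (simp add: numeral_2_eq_2)
  then have "hom_deg 1 (polar v p) \<and>
     (\<forall>a b. shift v a b p = a\<^sup>2 * p + a * b * polar v p + b\<^sup>2 * Cst (peval v p))"
  proof (induction p rule: hom_deg_induct)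
    case zero
    then show ?case by (simp add: polar_def ring_homD[OF ring_hom_shift] ring_homD[OF ring_hom_peval])
  next
    case (add p q)
    have "polar v (p + q) = polar v p + polar v q"
      by (simp add: polar_def ring_homD[OF ring_hom_shift] ring_homD[OF ring_hom_peval] Cst_arith)
    then show ?case using add
      by (simp add: hom_deg_add ring_homD[OF ring_hom_shift] ring_homD[OF ring_hom_peval] Cst_arith algebra_simps)
  next
    case (mult p i)
    have sh: "shift v a b (Var i * p) = (a * Var i + b * Cst (v i)) * (a * p + b * Cst (peval v p))" for a b
      by (simp only: ring_homD(3)[OF ring_hom_shift] shift_Var shift_linear[OF mult])
    have pol: "polar v (Var i * p) = Cst (peval v p) * Var i + Cst (v i) * p"
      unfolding polar_def sh by (simp add: ring_homD[OF ring_hom_peval] Cst_arith algebra_simps)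
    have "hom_deg 1 (polar v (Var i * p))"
      unfolding pol using mult by (intro hom_deg_add hom_deg_scale hom_deg_Var)
    moreover have "shift v a b (Var i * p) = a\<^sup>2 * (Var i * p) + a * b * polar v (Var i * p)
        + b\<^sup>2 * Cst (peval v (Var i * p))" for a b
      unfolding sh pol by (simp add: ring_homD[OF ring_hom_peval] Cst_arith algebra_simps power2_eq_square)
    ultimately show ?case by blast
  qed
  then show "hom_deg 1 (polar v p)"
    and "shift v a b p = a\<^sup>2 * p + a * b * polar v p + b\<^sup>2 * Cst (peval v p)" by auto
qed

lemma peval_quadratic:
  assumes "hom_deg 2 p"
  shows "peval (\<lambda>i. w i + t * v i) p = peval w p + t * peval w (polar v p) + t\<^sup>2 * peval v p"
proof -
  have "peval (\<lambda>i. w i + t * v i) q = peval w (shift v 1 (Cst t) q)" for q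
    by (rule ring_hom_eqI[of "peval (\<lambda>i. w i + t * v i)" "\<lambda>q. peval w (shift v 1 (Cst t) q)"])
       (simp_all add: ring_hom_peval ring_hom_comp[OF ring_hom_peval ring_hom_shift] ring_homD[OF ring_hom_peval])
  then show ?thesis
    by (simp add: shift_quadratic[OF assms] ring_homD[OF ring_hom_peval])
qed

lemma peval_polar: "peval w (polar v p) = peval (\<lambda>i. w i + v i) p - peval w p - peval v p"
proof -
  have "peval (\<lambda>i. w i + v i) q = peval w (shift v 1 1 q)" for q
    by (rule ring_hom_eqI[of "peval (\<lambda>i. w i + v i)" "\<lambda>q. peval w (shift v 1 1 q)"])
       (simp_all add: ring_hom_peval ring_hom_comp[OF ring_hom_peval ring_hom_shift] ring_homD[OF ring_hom_peval])
  then show ?thesis by (simp add: polar_def ring_homD[OF ring_hom_peval])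
qed

text \<open>If \<open>v\<close> were singular on the member of the pencil through \<open>v\<close> for all \<open>v\<close>, then \<open>B / A\<close> would
  be constant.\<close>
lemma exists_good_point:
  assumes A: "hom_deg 2 A" and B: "hom_deg 2 B"
    and indep: "\<And>\<alpha> \<beta>. Cst \<alpha> * A + Cst \<beta> * B = 0 \<Longrightarrow> \<alpha> = 0 \<and> \<beta> = 0"
  shows "\<exists>v. peval v A \<noteq> 0 \<and> Cst (peval v A) * polar v B \<noteq> Cst (peval v B) * polar v A"
proof -
  have "A \<noteq> 0" using indep[of 1 0] by auto
  then obtain v where v: "peval v A \<noteq> 0" using exists_peval_nonzero by blast
  define a where "a = peval v A"
  \<comment> \<open>The member of the pencil through \<open>v\<close>. If its polar form at
    \<open>v\<close> is nonzero, \<open>v\<close> itself will do; otherwise \<open>C\<close> is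
    constant along the direction \<open>v\<close>.\<close>
  define C where "C = Cst a * B - Cst (peval v B) * A"
  have C: "hom_deg 2 C" unfolding C_def by (intro hom_deg_diff hom_deg_scale A B)
  have polC: "polar w C = Cst a * polar w B - Cst (peval v B) * polar w A" for w
    by (simp add: C_def polar_diff polar_scale)
  have evC: "peval w C = a * peval w B - peval v B * peval w A" for w
    by (simp add: C_def ring_homD[OF ring_hom_peval])
  have Cv: "peval v C = 0" by (simp add: evC a_def)
  show ?thesis
  proof (cases "polar v C = 0")
    case False
    then show ?thesis using v by (intro exI[of _ v]) (auto simp: polC a_def)
  next
    case True
    have "C \<noteq> 0" using indep[of "- peval v B" a] v by (auto simp: C_def a_def Cst_arith)
    then obtain w where w: "peval w C \<noteq> 0" using exists_peval_nonzero by blast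
    define a1 where "a1 = peval w (polar v A)"
    \<comment> \<open>In \<open>t\<close>, the first factor is \<open>A\<close> at
      \<open>w + t v\<close>. The second is its derivative, which is also the polar form of
      \<open>A\<close> at \<open>w + t v\<close> evaluated at \<open>v\<close>. Neither may vanish
      at the new point \<open>u\<close>.\<close>
    have "[:peval w A, a1, a:] * [:a1, 2 * a:] \<noteq> 0" using v by (simp add: a_def)
    then obtain t where "poly ([:peval w A, a1, a:] * [:a1, 2 * a:]) t \<noteq> 0"
      using poly_all_0_iff_0 by blast
    moreover have "poly ([:peval w A, a1, a:] * [:a1, 2 * a:]) t
        = (peval w A + t * a1 + t\<^sup>2 * a) * (a1 + 2 * t * a)"
      by (simp add: algebra_simps power2_eq_square)
    ultimately have t: "peval w A + t * a1 + t\<^sup>2 * a \<noteq> 0" "a1 + 2 * t * a \<noteq> 0" by auto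
    define u where "u = (\<lambda>i. w i + t * v i)"
    have shift: "(\<lambda>i. v i + u i) = (\<lambda>i. w i + (t + 1) * v i)" by (auto simp: u_def algebra_simps)
    have uA: "peval u A = peval w A + t * a1 + t\<^sup>2 * a"
      using peval_quadratic[OF A, of w t v] by (simp add: u_def a1_def a_def)
    have uC: "peval u C = peval w C"
      using peval_quadratic[OF C, of w t v] by (simp add: u_def True Cv ring_homD[OF ring_hom_peval])
    have pA: "peval v (polar u A) = a1 + 2 * t * a"
      unfolding peval_polar shift uA using peval_quadratic[OF A, of w "t + 1" v]
      by (simp add: a1_def a_def algebra_simps power2_eq_square)
    have pC: "peval v (polar u C) = 0"
      unfolding peval_polar shift uC Cv using peval_quadratic[OF C, of w "t + 1" v]
      by (simp add: True Cv ring_homD[OF ring_hom_peval])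
    \<comment> \<open>An equality here would imply the same equality with \<open>C\<close> in place
      of \<open>B\<close>. At \<open>v\<close> its left side is 0, because \<open>C\<close> is
      constant along \<open>v\<close>, and its right side is not.\<close>
    have "Cst (peval u A) * polar u B \<noteq> Cst (peval u B) * polar u A"
    proof
      assume "Cst (peval u A) * polar u B = Cst (peval u B) * polar u A"
      then have "peval v (Cst (peval u A) * polar u B) = peval v (Cst (peval u B) * polar u A)" by simp
      then have "peval u A * peval v (polar u B) = peval u B * peval v (polar u A)"
        by (simp add: ring_homD[OF ring_hom_peval])
      then have "peval u A * peval v (polar u C) = peval u C * peval v (polar u A)"
        by (simp add: polC evC ring_homD[OF ring_hom_peval] algebra_simps)
      then show False using pA pC uC w t(2) by simp
    qed
    then show ?thesis using uA t(1) by metis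
  qed
qed

subsection \<open>Pencils of quadratic forms\<close>

text \<open>Modulo \<open>l\<close> one gets \<open>B0 = b m\<close> and \<open>A0 = m\<^sup>2\<close>, so that \<open>x + m\<close> divides everything.\<close>
lemma linear_factor_case:
  fixes b l x A0 B0 :: "'v::linorder cpoly"
  assumes b: "hom_deg 1 b" "b \<noteq> 0" and B0: "hom_deg 2 B0" "\<not> b dvd B0" and l: "hom_deg 1 l" "l \<noteq> 0"
    and x: "hom_deg 1 x" and F: "l dvd B0\<^sup>2 - b\<^sup>2 * A0"
  shows "\<exists>u. hom_deg 1 u \<and> x\<^sup>2 - A0 \<in> ideal_gen {u, l} \<and> x * b + B0 \<in> ideal_gen {u, l}
     \<and> (\<forall>c D. l dvd b * D - B0 * c \<longrightarrow> x * c + D \<in> ideal_gen {u, l})"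
proof -
  obtain \<sigma> where \<sigma>: "ring_hom \<sigma>" "\<sigma> l = 0" "\<And>p. l dvd p - \<sigma> p"
    and \<sigma>hom: "\<And>d p. hom_deg d p \<Longrightarrow> hom_deg d (\<sigma> p)"
    using linear_retraction[OF l] by blast
  note \<sigma>_simps = ring_homD[OF \<sigma>(1)]
  note dvd_iff = retraction_dvd_iff[OF \<sigma>]
  have idem: "\<sigma> (\<sigma> p) = \<sigma> p" for p
    using \<sigma>(3)[of p] by (simp add: dvd_iff \<sigma>_simps)
  have FF: "(\<sigma> B0)\<^sup>2 = (\<sigma> b)\<^sup>2 * \<sigma> A0" using F by (simp add: dvd_iff \<sigma>_simps)
  \<comment> \<open>Otherwise \<open>l\<close> is proportional to \<open>b\<close> and divides
    \<open>B0\<close>, so \<open>b\<close> would divide \<open>B0\<close>.\<close>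
  have "\<sigma> b \<noteq> 0"
  proof
    assume "\<sigma> b = 0"
    then have "\<sigma> B0 = 0" using FF by simp
    then have "l dvd b" "l dvd B0" using \<open>\<sigma> b = 0\<close> by (simp_all add: dvd_iff)
    then obtain c where c: "c \<noteq> 0" "b = Cst c * l" using hom_deg_same_dvd[OF l(1) b(1) _ b(2)] by blast
    then have "l = b * Cst (inverse c)" using Cst_cancel(2)[OF c(1), of l] by (simp add: mult.commute)
    then show False using \<open>l dvd B0\<close> B0(2) by (metis dvd_trans dvd_triv_left)
  qed
  have prime: "prime_elem (\<sigma> b)" by (rule linear_prime_elem[OF \<sigma>hom[OF b(1)] \<open>\<sigma> b \<noteq> 0\<close>])
  have "\<sigma> b dvd \<sigma> B0 * \<sigma> B0" using FF by (simp add: power2_eq_square)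
  then have "\<sigma> b dvd \<sigma> B0" using prime by (auto simp: prime_elem_def)
  then obtain m where m: "\<sigma> B0 = \<sigma> b * m" by (rule dvdE)
  have "\<sigma> b * \<sigma> m = \<sigma> b * m" using idem[of B0] by (simp add: m \<sigma>_simps idem)
  then have \<sigma>m: "\<sigma> m = m" using \<open>\<sigma> b \<noteq> 0\<close> by simp
  have "hom_deg (1 + 1) (\<sigma> b * m)" using \<sigma>hom[OF B0(1)] by (simp add: m numeral_2_eq_2)
  then have hm: "hom_deg 1 m" by (rule hom_deg_quotient[OF _ \<sigma>hom[OF b(1)] \<open>\<sigma> b \<noteq> 0\<close>])
  have A0: "\<sigma> A0 = m\<^sup>2" using FF \<open>\<sigma> b \<noteq> 0\<close> by (simp add: m power_mult_distrib)
  define u where "u = \<sigma> x + m"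
  have in_ideal: "p \<in> ideal_gen {u, l}" if p: "\<sigma> p = k * u" for p k
  proof -
    obtain z where "p - \<sigma> p = l * z" using \<sigma>(3)[of p] by (rule dvdE)
    then have "p = k * u + z * l" using p by (simp add: algebra_simps)
    then show ?thesis unfolding ideal_gen_pair by blast
  qed
  show ?thesis
  proof (intro exI[of _ u] conjI allI impI)
    show "hom_deg 1 u" unfolding u_def by (intro hom_deg_add \<sigma>hom x hm)
    show "x\<^sup>2 - A0 \<in> ideal_gen {u, l}"
      by (rule in_ideal[of _ "\<sigma> x - m"]) (simp add: \<sigma>_simps A0 u_def algebra_simps power2_eq_square)
    show "x * b + B0 \<in> ideal_gen {u, l}"
      by (rule in_ideal[of _ "\<sigma> b"]) (simp add: \<sigma>_simps m u_def algebra_simps)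
    fix c D assume "l dvd b * D - B0 * c"
    \<comment> \<open>With \<open>B0\<close> congruent to \<open>b m\<close>, cancelling
      \<open>b\<close> leaves \<open>D\<close> congruent to \<open>m c\<close>, so
      \<open>x c + D\<close> is congruent to \<open>c (x + m)\<close> modulo
      \<open>l\<close>.\<close>
    then have "\<sigma> b * \<sigma> D = \<sigma> b * (m * \<sigma> c)" by (simp add: dvd_iff \<sigma>_simps m mult.assoc)
    then have "\<sigma> D = m * \<sigma> c" using \<open>\<sigma> b \<noteq> 0\<close> by simp
    then show "x * c + D \<in> ideal_gen {u, l}"
      by (intro in_ideal[of _ "\<sigma> c"]) (simp add: \<sigma>_simps u_def algebra_simps)
  qed
qed

lemma complex_quadratic_factors: "\<exists>e1 e2 :: complex. e1 + e2 = p \<and> e1 * e2 = q"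
proof -
  define s where "s = csqrt (p\<^sup>2 - 4 * q)"
  have "s\<^sup>2 = p\<^sup>2 - 4 * q" by (simp add: s_def)
  then show ?thesis
    by (intro exI[of _ "(p + s) / 2"] exI[of _ "(p - s) / 2"])
       (simp add: field_simps power2_eq_square)
qed

text \<open>For \<open>f g = B0\<^sup>2 - b\<^sup>2 A0\<close>, the factors \<open>f\<close> and \<open>g\<close> reduce modulo \<open>b\<close> either both to multiples
  of \<open>B0\<close>, or to squares \<open>u\<^sup>2\<close> and \<open>w\<^sup>2\<close> with \<open>B0 \<equiv> u w\<close>. In the second case \<open>f\<close> is a quadratic form in
  \<open>u\<close> and \<open>b\<close> alone, hence splits.\<close>
context
  fixes b A0 B0 :: "'v::linorder cpoly"
  assumes b: "hom_deg 1 b" "b \<noteq> 0" and B0: "hom_deg 2 B0" "\<not> b dvd B0"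
begin

text \<open>After rescaling, both factors are congruent to \<open>B0\<close> modulo
  \<open>b\<close>, say \<open>B0 + b m\<close> and \<open>B0 + b m'\<close>. Comparing products
  forces \<open>b\<close> to divide \<open>m + m'\<close>, so \<open>m' = t b - m\<close>. The
  resulting formula for \<open>A0\<close> is what makes \<open>x - m\<close> a factor of
  \<open>(x\<^sup>2 - A0) - t (x b + B0)\<close>.\<close>

lemma proportional_factors:
  assumes f: "hom_deg 2 f" and g: "hom_deg 2 g" and fg: "f * g = B0\<^sup>2 - b\<^sup>2 * A0"
    and k: "b dvd B0 - Cst k * f"
  shows "\<exists>m t. hom_deg 1 m \<and> A0 = m\<^sup>2 - Cst t * b * m - Cst t * B0"
proof -
  have prime: "prime_elem b" by (rule linear_prime_elem[OF b])
  have "k \<noteq> 0" using k B0(2) by auto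
  define f1 where "f1 = Cst k * f"
  define g1 where "g1 = Cst (inverse k) * g"
  have fg1: "f1 * g1 = B0\<^sup>2 - b\<^sup>2 * A0"
  proof -
    have "f1 * g1 = Cst k * (Cst (inverse k) * (f * g))" unfolding f1_def g1_def by (simp only: ac_simps)
    then show ?thesis using \<open>k \<noteq> 0\<close> fg by simp
  qed
  have hom1: "hom_deg 2 f1" "hom_deg 2 g1" unfolding f1_def g1_def by (intro hom_deg_scale f g)+
  have "b dvd f1 - B0" using k dvd_minus_iff[of b "B0 - Cst k * f"] by (simp add: f1_def)
  then obtain m where m: "f1 - B0 = b * m" by (rule dvdE)
  have "b * (m * g1) = B0 * (B0 - g1) - b * (b * A0)"
    using fg1 m by (simp add: algebra_simps power2_eq_square eq_diff_eq)
  then have "b dvd B0 * (B0 - g1)" by (metis diff_add_cancel dvd_add dvd_triv_left)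
  then have "b dvd B0 - g1" using prime B0(2) by (auto simp: prime_elem_def)
  then have "b dvd g1 - B0" using dvd_minus_iff[of b "B0 - g1"] by simp
  then obtain m' where m': "g1 - B0 = b * m'" by (rule dvdE)
  have hom: "hom_deg 1 s" if "b * s = q - B0" "hom_deg 2 q" for s q
    using hom_deg_diff[OF that(2) B0(1)] that(1) hom_deg_quotient[OF _ b, of 1 s] by (simp add: numeral_2_eq_2)
  have hm: "hom_deg 1 m" "hom_deg 1 m'" using hom[OF _ hom1(1)] hom[OF _ hom1(2)] m m' by auto
  have f1: "f1 = B0 + b * m" and g1: "g1 = B0 + b * m'" using m m' by (simp_all add: algebra_simps)
  have "b * (B0 * (m + m') + b * m * m') = f1 * g1 - B0\<^sup>2"
    unfolding f1 g1 by (simp add: algebra_simps power2_eq_square)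
  also have "\<dots> = b * (- (b * A0))" by (simp add: fg1 power2_eq_square mult.assoc)
  finally have eq: "B0 * (m + m') + b * m * m' = - (b * A0)" using b(2) by (metis mult_cancel_left)
  then have "B0 * (m + m') = b * (- A0 - m * m')" by (simp add: algebra_simps eq_diff_eq)
  then have "b dvd B0 * (m + m')" by simp
  then have "b dvd m + m'" using prime B0(2) by (auto simp: prime_elem_def)
  then have "\<exists>t. m + m' = Cst t * b"
    using hom_deg_same_dvd[OF b(1) hom_deg_add[OF hm]] by (metis Cst_simps(2) mult_zero_left)
  then obtain t where t: "m + m' = Cst t * b" ..
  then have m't: "m' = Cst t * b - m" by (simp add: algebra_simps eq_diff_eq)
  have "b * (- A0) = b * (Cst t * B0 + m * m')" using eq unfolding t by (simp add: ac_simps distrib_left)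
  then have "- A0 = Cst t * B0 + m * m'" using b(2) by (metis mult_cancel_left)
  then have "A0 = m\<^sup>2 - Cst t * b * m - Cst t * B0"
    unfolding m't by (simp add: algebra_simps power2_eq_square minus_equation_iff[of A0])
  then show ?thesis using hm(1) by blast
qed

text \<open>Write \<open>f = u\<^sup>2 + b p\<close>, \<open>g = w\<^sup>2 + b q\<close>,
  \<open>B0 = u w + b r\<close>. The terms linear in \<open>b\<close> show that \<open>u\<close>
  divides \<open>w\<^sup>2 p\<close> modulo \<open>b\<close>, hence \<open>p\<close> modulo
  \<open>b\<close>. So \<open>p = e u + e' b\<close>, and
  \<open>f = u\<^sup>2 + e u b + e' b\<^sup>2\<close> splits over the complex numbers.\<close>

lemma square_factors:
  assumes fg: "f * g = B0\<^sup>2 - b\<^sup>2 * A0" and f: "hom_deg 2 f"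
    and \<sigma>: "ring_hom \<sigma>" "\<sigma> b = 0" "\<And>p. b dvd p - \<sigma> p" "\<And>c. \<sigma> (Cst c) = Cst c" "\<And>d p. hom_deg d p \<Longrightarrow> hom_deg d (\<sigma> p)"
    and u: "hom_deg 1 u" "u \<noteq> 0" "\<sigma> u = u" and w: "\<sigma> w = w" "\<not> u dvd w"
    and eqs: "\<sigma> f = u\<^sup>2" "\<sigma> g = w\<^sup>2" "\<sigma> B0 = u * w"
  shows "\<exists>l. hom_deg 1 l \<and> l \<noteq> 0 \<and> l dvd f"
proof -
  note \<sigma>_simps = ring_homD[OF \<sigma>(1)]
  obtain p where p: "f - u\<^sup>2 = b * p" using \<sigma>(3)[of f] eqs(1) by (auto elim: dvdE)
  obtain q where q: "g - w\<^sup>2 = b * q" using \<sigma>(3)[of g] eqs(2) by (auto elim: dvdE)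
  obtain r where r: "B0 - u * w = b * r" using \<sigma>(3)[of B0] eqs(3) by (auto elim: dvdE)
  have f': "f = u\<^sup>2 + b * p" and g': "g = w\<^sup>2 + b * q" and B': "B0 = u * w + b * r"
    using p q r by (simp_all add: algebra_simps)
  have "b * (u\<^sup>2 * q + w\<^sup>2 * p - 2 * u * w * r) = b * (b * (r\<^sup>2 - A0 - p * q))"
    using fg unfolding f' g' B' by (simp add: algebra_simps power2_eq_square)
  then have "u\<^sup>2 * q + w\<^sup>2 * p - 2 * u * w * r = b * (r\<^sup>2 - A0 - p * q)"
    using b(2) by (metis mult_cancel_left)
  then have "\<sigma> (u\<^sup>2 * q + w\<^sup>2 * p - 2 * u * w * r) = 0" by (simp add: \<sigma>_simps \<sigma>(2))
  moreover have "\<sigma> 2 = 2" using \<sigma>(4)[of 2] by simp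
  ultimately have "w * w * \<sigma> p = u * (2 * w * \<sigma> r - u * \<sigma> q)"
    by (simp add: \<sigma>_simps u w algebra_simps power2_eq_square)
  then have "u dvd w * w * \<sigma> p" by simp
  then have "u dvd \<sigma> p" using linear_prime_elem[OF u(1,2)] w(2) by (auto simp: prime_elem_def)
  have "hom_deg (1 + 1) (b * p)"
    using hom_deg_diff[OF f hom_deg_power2[OF u(1)]] p by (simp add: numeral_2_eq_2)
  then have hp: "hom_deg 1 p" by (rule hom_deg_quotient[OF _ b])
  have "\<exists>e. \<sigma> p = Cst e * u"
    using hom_deg_same_dvd[OF u(1) \<sigma>(5)[OF hp] \<open>u dvd \<sigma> p\<close>] by (metis Cst_simps(2) mult_zero_left)
  then obtain e where e: "\<sigma> p = Cst e * u" ..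
  have "\<exists>e'. p - \<sigma> p = Cst e' * b"
    using hom_deg_same_dvd[OF b(1) hom_deg_diff[OF hp \<sigma>(5)[OF hp]] \<sigma>(3)] by (metis Cst_simps(2) mult_zero_left)
  then obtain e' where e': "p - \<sigma> p = Cst e' * b" ..
  obtain e1 e2 where e12: "e1 + e2 = e" "e1 * e2 = e'" using complex_quadratic_factors by blast
  have p': "p = Cst e * u + Cst e' * b" using e e' by (simp add: algebra_simps)
  have "f = (u + Cst e1 * b) * (u + Cst e2 * b)"
    unfolding f' p' e12[symmetric] by (simp add: Cst_arith algebra_simps power2_eq_square)
  then have "u + Cst e1 * b dvd f" by simp
  moreover have "hom_deg 1 (u + Cst e1 * b)" by (intro hom_deg_add hom_deg_scale u b)
  moreover have "\<sigma> (u + Cst e1 * b) = u" by (simp add: \<sigma>_simps \<sigma>(2) u)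
  then have "u + Cst e1 * b \<noteq> 0" using u(2) \<sigma>_simps(4) by metis
  ultimately show ?thesis by blast
qed

text \<open>Modulo \<open>b\<close> the product of \<open>f\<close> and \<open>g\<close> is the
  square of \<open>B0\<close>. If \<open>f\<close> stays irreducible there, it divides
  \<open>B0\<close>, and equal degrees give proportionality. If it becomes \<open>u1 u2\<close>,
  then \<open>B0\<close> becomes \<open>u1 w\<close>, and \<open>u2\<close> divides \<open>w\<close>
  (proportionality again) or is proportional to \<open>u1\<close> (squares).\<close>

lemma quadratic_factors_case:
  assumes f: "hom_deg 2 f" and g: "hom_deg 2 g" and fg: "f * g = B0\<^sup>2 - b\<^sup>2 * A0"
  shows "(\<exists>l. hom_deg 1 l \<and> l \<noteq> 0 \<and> l dvd f)
    \<or> (\<exists>m t. hom_deg 1 m \<and> A0 = m\<^sup>2 - Cst t * b * m - Cst t * B0)"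
proof -
  obtain \<sigma> where \<sigma>: "ring_hom \<sigma>" "\<sigma> b = 0" "\<And>p. b dvd p - \<sigma> p" "\<And>c. \<sigma> (Cst c) = Cst c"
    "\<And>d p. hom_deg d p \<Longrightarrow> hom_deg d (\<sigma> p)"
    using linear_retraction[OF b] by blast
  note \<sigma>_simps = ring_homD[OF \<sigma>(1)]
  note dvd_iff = retraction_dvd_iff[OF \<sigma>(1-3)]
  have idem: "\<sigma> (\<sigma> p) = \<sigma> p" for p
    using \<sigma>(3)[of p] by (simp add: dvd_iff \<sigma>_simps)
  have proportional: ?thesis if "\<sigma> B0 = Cst k * \<sigma> f" for k
    using proportional_factors[OF f g fg, of k] that by (simp add: dvd_iff \<sigma>_simps \<sigma>(4))
  have B0nz: "\<sigma> B0 \<noteq> 0" using B0(2) by (simp add: dvd_iff)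
  have eq: "\<sigma> f * \<sigma> g = \<sigma> B0 * \<sigma> B0"
    using arg_cong[OF fg, of \<sigma>] by (simp add: \<sigma>_simps \<sigma>(2) power2_eq_square)
  then have nz: "\<sigma> f \<noteq> 0" using B0nz by auto
  show ?thesis
  proof (cases "irreducible (\<sigma> f)")
    case True
    then have "prime_elem (\<sigma> f)" by (rule cpoly_irreducible_imp_prime_elem)
    moreover have "\<sigma> f dvd \<sigma> B0 * \<sigma> B0" unfolding eq[symmetric] by simp
    ultimately have "\<sigma> f dvd \<sigma> B0" by (auto simp: prime_elem_def)
    then show ?thesis
      using hom_deg_same_dvd[OF \<sigma>(5)[OF f] \<sigma>(5)[OF B0(1)] _ B0nz] proportional by blast
  next
    case False
    obtain i j v1 v2 where v: "\<sigma> f = v1 * v2" "hom_deg i v1" "hom_deg j v2" "i > 0" "j > 0" "i + j = 2"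
      using reducible_hom_deg[OF \<sigma>(5)[OF f] nz _ False] by auto
    then have ij: "i = 1" "j = 1" by auto
    \<comment> \<open>Applying \<open>\<sigma>\<close> once more yields factors fixed by
      \<open>\<sigma>\<close>.\<close>
    define u1 where "u1 = \<sigma> v1"
    define u2 where "u2 = \<sigma> v2"
    have u: "\<sigma> f = u1 * u2" using v(1) idem[of f] by (simp add: u1_def u2_def \<sigma>_simps)
    have hu: "hom_deg 1 u1" "hom_deg 1 u2" using v ij \<sigma>(5) by (auto simp: u1_def u2_def)
    have u0: "u1 \<noteq> 0" "u2 \<noteq> 0" using u nz by auto
    have \<sigma>u: "\<sigma> u1 = u1" "\<sigma> u2 = u2" by (simp_all add: u1_def u2_def idem)
    note prime = linear_prime_elem[OF hu(1) u0(1)] linear_prime_elem[OF hu(2) u0(2)]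
    have "u1 dvd \<sigma> B0 * \<sigma> B0" unfolding eq[symmetric] u by (simp add: mult.assoc)
    then have "u1 dvd \<sigma> B0" using prime(1) by (auto simp: prime_elem_def)
    then obtain w where w: "\<sigma> B0 = u1 * w" by (rule dvdE)
    have "u1 * \<sigma> w = u1 * w" using idem[of B0] by (simp add: w \<sigma>_simps \<sigma>u)
    then have \<sigma>w: "\<sigma> w = w" using u0 by simp
    have "hom_deg (1 + 1) (u1 * w)" using \<sigma>(5)[OF B0(1)] w by (simp add: numeral_2_eq_2)
    then have hw: "hom_deg 1 w" by (rule hom_deg_quotient[OF _ hu(1) u0(1)])
    have "w \<noteq> 0" using w B0nz by auto
    have "u1 * (u2 * \<sigma> g) = u1 * (u1 * w * w)" using eq by (simp add: u w algebra_simps)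
    then have eq2: "u2 * \<sigma> g = u1 * w * w" using u0 by simp
    then have "u2 dvd u1 * w * w" by (metis dvd_triv_left)
    then have "u2 dvd u1 \<or> u2 dvd w" using prime(2) by (auto simp: prime_elem_def)
    then show ?thesis
    proof
      assume "u2 dvd w"
      then obtain c where "w = Cst c * u2" using hom_deg_same_dvd[OF hu(2) hw _ \<open>w \<noteq> 0\<close>] by blast
      then have "\<sigma> B0 = Cst c * \<sigma> f" by (simp add: w u algebra_simps)
      then show ?thesis by (rule proportional)
    next
      assume "u2 dvd u1"
      then obtain c where c: "c \<noteq> 0" "u1 = Cst c * u2" using hom_deg_same_dvd[OF hu(2,1) _ u0(1)] by blast
      show ?thesis
      proof (cases "u2 dvd w")
        case True
        then obtain k where "w = Cst k * u2" using hom_deg_same_dvd[OF hu(2) hw _ \<open>w \<noteq> 0\<close>] by blast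
        then have "\<sigma> B0 = Cst k * \<sigma> f" by (simp add: w u algebra_simps)
        then show ?thesis by (rule proportional)
      next
        case False
        have "u2 * \<sigma> g = u2 * (Cst c * w * w)" using eq2 by (simp add: c(2) algebra_simps)
        then have \<sigma>g: "\<sigma> g = Cst c * w * w" using u0 by simp
        \<comment> \<open>Moving the constant \<open>c\<close> from \<open>f\<close> to
          \<open>g\<close> turns the images into the exact squares of \<open>u2\<close> and
          \<open>c w\<close>, and \<open>B0\<close> maps to their product
          \<open>u2 (c w)\<close>.\<close>
        define f1 where "f1 = Cst (inverse c) * f"
        define g1 where "g1 = Cst c * g"
        have fg1: "f1 * g1 = B0\<^sup>2 - b\<^sup>2 * A0"
        proof -
          have "f1 * g1 = Cst c * (Cst (inverse c) * (f * g))" unfolding f1_def g1_def by (simp only: ac_simps)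
          then show ?thesis using c(1) fg by simp
        qed
        have hf1: "hom_deg 2 f1" unfolding f1_def by (rule hom_deg_scale[OF f])
        have "\<not> u2 dvd Cst c * w"
          using False Cst_cancel(2)[OF c(1), of w] by (metis dvd_mult)
        moreover have "\<sigma> f1 = u2\<^sup>2"
          unfolding f1_def \<sigma>_simps \<sigma>(4) u c(2) using Cst_cancel(2)[OF c(1), of "u2 * u2"]
          by (simp add: power2_eq_square algebra_simps)
        ultimately have "\<exists>l. hom_deg 1 l \<and> l \<noteq> 0 \<and> l dvd f1"
          by (intro square_factors[OF fg1 hf1 \<sigma> hu(2) u0(2) \<sigma>u(2), of "Cst c * w"])
             (simp_all add: g1_def \<sigma>_simps \<sigma>(4) \<sigma>w \<sigma>g w c(2) power2_eq_square algebra_simps)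
        then obtain l where "hom_deg 1 l" "l \<noteq> 0" "l dvd f1" by blast
        moreover have "f = Cst c * f1" using Cst_cancel(1)[OF c(1), of f] by (simp add: f1_def)
        ultimately show ?thesis by auto
      qed
    qed
  qed
qed

end

text \<open>Disposes of pencils whose members are all multiples of one form \<open>C\<close>. An
  irreducible \<open>C\<close> is prime and divides some \<open>Q k\<close> of equal degree; a
  reducible one is a product of linear forms; and \<open>C = 0\<close> forces some
  \<open>Q k = 0\<close>.\<close>

lemma dependent_pencil_case:
  fixes A B C :: "'v::linorder cpoly"
  assumes "finite K" and Q: "\<And>k. k \<in> K \<Longrightarrow> hom_deg 2 (Q k)" and C: "hom_deg 2 C"
    and "C dvd (\<Prod>k\<in>K. Q k) ^ n"
  shows "(\<exists>k\<in>K. \<exists>\<gamma>. Q k = Cst \<gamma> * C)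
    \<or> (\<exists>c d. hom_deg 1 c \<and> hom_deg 1 d \<and> c \<noteq> 0 \<and> d \<noteq> 0 \<and> C = c * d)"
proof -
  consider "C = 0" | "C \<noteq> 0" "irreducible C" | "C \<noteq> 0" "\<not> irreducible C" by blast
  then show ?thesis
  proof cases
    case 1
    then have "(\<Prod>k\<in>K. Q k) ^ n = 0" using assms(4) by simp
    then have "(\<Prod>k\<in>K. Q k) = 0" by simp
    then obtain k where "k \<in> K" "Q k = 0" using assms(1) by auto
    then show ?thesis using 1 by auto
  next
    case 2
    then have prime: "prime_elem C" by (intro cpoly_irreducible_imp_prime_elem)
    then have "C dvd (\<Prod>k\<in>K. Q k)" using assms(4) by (rule prime_elem_dvd_power)
    then obtain k where k: "k \<in> K" "C dvd Q k" using prime_elem_dvd_prod[OF prime assms(1)] by blast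
    then have "\<exists>\<gamma>. Q k = Cst \<gamma> * C"
      using hom_deg_same_dvd[OF C Q[OF k(1)] k(2)] by (metis Cst_simps(2) mult_zero_left)
    then show ?thesis using k(1) by blast
  next
    case 3
    then obtain i j c d where cd: "C = c * d" "hom_deg i c" "hom_deg j d" "i > 0" "j > 0" "i + j = 2"
      using reducible_hom_deg[OF C] by auto
    then have "i = 1" "j = 1" by auto
    then have "hom_deg 1 c" "hom_deg 1 d" using cd(2,3) by simp_all
    moreover have "c \<noteq> 0" "d \<noteq> 0" using cd(1) 3(1) by auto
    ultimately
    show ?thesis using cd(1) by blast
  qed
qed


text \<open>Linear forms have to be nonzero; a vanishing generator is replaced by a copy of the
  other one.\<close>

lemma ideal_gen_zero:
  assumes "p \<in> ideal_gen {0, d}"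
  shows "p \<in> ideal_gen {d, d}"
proof -
  obtain r s where "p = r * 0 + s * d" using assms unfolding ideal_gen_pair by blast
  then have "p = 0 * d + s * d" by simp
  then show ?thesis unfolding ideal_gen_pair by blast
qed

text \<open>The theorem over linearly ordered variables. Failure of (i) and (ii) is assumed as
  \<open>no_span\<close> and \<open>no_split\<close>, which leaves (iii).\<close>

lemma quadric_pencil_main:
  fixes A B :: "'v::linorder cpoly"
  assumes "finite K" and Q: "\<And>k. k \<in> K \<Longrightarrow> hom_deg 2 (Q k)"
    and A: "hom_deg 2 A" and B: "hom_deg 2 B"
    and rs: "(\<Prod>k\<in>K. Q k) ^ n = r * A + s * B"
    and no_split: "\<And>\<alpha> \<beta> c d. hom_deg 1 c \<Longrightarrow> hom_deg 1 d \<Longrightarrow> c \<noteq> 0 \<Longrightarrow> d \<noteq> 0 \<Longrightarrow> \<alpha> \<noteq> 0 \<or> \<beta> \<noteq> 0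
       \<Longrightarrow> Cst \<alpha> * A + Cst \<beta> * B \<noteq> c * d"
    and no_span: "\<And>k \<alpha> \<beta>. k \<in> K \<Longrightarrow> Q k \<noteq> Cst \<alpha> * A + Cst \<beta> * B"
  shows "\<exists>c d. hom_deg 1 c \<and> hom_deg 1 d \<and> c \<noteq> 0 \<and> d \<noteq> 0 \<and> A \<in> ideal_gen {c, d} \<and> B \<in> ideal_gen {c, d}
    \<and> (\<exists>k\<in>K. Q k \<in> ideal_gen {c, d})"
proof -
  \<comment> \<open>No nontrivial combination divides both generators. Applied to \<open>A\<close>
    and \<open>B\<close> themselves, this yields linear independence.\<close>
  have dep: False if "C = Cst \<alpha> * A + Cst \<beta> * B" "\<alpha> \<noteq> 0 \<or> \<beta> \<noteq> 0" "C dvd A" "C dvd B" for C \<alpha> \<beta>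
  proof -
    have "hom_deg 2 C" unfolding that(1) by (intro hom_deg_add hom_deg_scale A B)
    moreover have "C dvd (\<Prod>k\<in>K. Q k) ^ n" unfolding rs using that(3,4) by simp
    ultimately consider k \<gamma> where "k \<in> K" "Q k = Cst \<gamma> * C"
      | c d where "hom_deg 1 c" "hom_deg 1 d" "c \<noteq> 0" "d \<noteq> 0" "C = c * d"
      using dependent_pencil_case[where Q = Q, OF assms(1) Q] by blast
    then show False
    proof cases
      case 1
      then have "Q k = Cst (\<gamma> * \<alpha>) * A + Cst (\<gamma> * \<beta>) * B"
        by (simp add: that(1) Cst_arith algebra_simps)
      then show False using no_span 1 by blast
    next
      case 2
      then show False using no_split[of c d \<alpha> \<beta>] that by simp
    qed
  qed
  have indep: "\<alpha> = 0 \<and> \<beta> = 0" if eq: "Cst \<alpha> * A + Cst \<beta> * B = 0" for \<alpha> \<beta>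
  proof (rule ccontr)
    assume "\<not> (\<alpha> = 0 \<and> \<beta> = 0)"
    then consider "\<beta> \<noteq> 0" | "\<alpha> \<noteq> 0" by blast
    then show False
    proof cases
      case 1
      have "Cst \<beta> * B = Cst (- \<alpha>) * A" using eq by (simp add: Cst_arith eq_neg_iff_add_eq_0 add.commute)
      then have "Cst (inverse \<beta>) * (Cst \<beta> * B) = Cst (inverse \<beta>) * Cst (- \<alpha>) * A" by (simp add: mult.assoc)
      then have "A dvd B" using 1 by (metis Cst_cancel(2) dvd_triv_right)
      then show False using dep[of A 1 0] by simp
    next
      case 2
      have "Cst \<alpha> * A = Cst (- \<beta>) * B" using eq by (simp add: Cst_arith eq_neg_iff_add_eq_0)
      then have "Cst (inverse \<alpha>) * (Cst \<alpha> * A) = Cst (inverse \<alpha>) * Cst (- \<beta>) * B" by (simp add: mult.assoc)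
      then have "B dvd A" using 2 by (metis Cst_cancel(2) dvd_triv_right)
      then show False using dep[of B 0 1] by simp
    qed
  qed
  obtain v where v: "peval v A \<noteq> 0" "Cst (peval v A) * polar v B \<noteq> Cst (peval v B) * polar v A"
    using exists_good_point[OF A B indep] by blast
  define A1 where "A1 = Cst (inverse (peval v A)) * A"
  define B1 where "B1 = B - Cst (peval v B) * A1"
  have hA1: "hom_deg 2 A1" and hB1: "hom_deg 2 B1"
    unfolding B1_def A1_def by (intro hom_deg_diff hom_deg_scale A B)+
  have evA1: "peval v A1 = 1" and evB1: "peval v B1 = 0"
    using v(1) by (simp_all add: A1_def B1_def ring_homD[OF ring_hom_peval])
  have A_A1: "A = Cst (peval v A) * A1" and B_B1: "B = B1 + Cst (peval v B) * A1"
    using v(1) by (simp_all add: A1_def B1_def)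
  define b where "b = polar v B1"
  \<comment> \<open>Halving completes the square in the direction \<open>v\<close>: since
    \<open>A1(v) = 1\<close>, the form \<open>x\<close> takes the value 1 at \<open>v\<close>, and
    \<open>x\<^sup>2\<close> has the same polar form at \<open>v\<close> as
    \<open>A1\<close>.\<close>
  define x where "x = Cst (1 / 2) * polar v A1"
  have hb: "hom_deg 1 b" and hx: "hom_deg 1 x"
    unfolding b_def x_def by (intro hom_deg_scale hom_deg_polar hA1 hB1)+
  \<comment> \<open>\<open>b\<close> is the polar form of \<open>B\<close> minus
    \<open>B(v) / A(v)\<close> times that of \<open>A\<close>; its vanishing is the equality
    excluded by the choice of \<open>v\<close>.\<close>
  have b0: "b \<noteq> 0"
  proof
    assume "b = 0"
    then have "polar v B = Cst (peval v B) * (Cst (inverse (peval v A)) * polar v A)"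
      by (simp add: b_def B1_def A1_def polar_diff polar_scale)
    then have "Cst (peval v A) * polar v B = Cst (peval v B) * (Cst (peval v A) * (Cst (inverse (peval v A)) * polar v A))"
      by (simp only: ac_simps)
    then show False using v by simp
  qed
  have polA1: "polar v A1 = 2 * x"
    using Cst_cancel(1)[of 2 "polar v A1"] by (simp add: x_def inverse_eq_divide)
  define A0 where "A0 = x\<^sup>2 - A1"
  define B0 where "B0 = B1 - x * b"
  define F where "F = B0\<^sup>2 - b\<^sup>2 * A0"
  have hB0: "hom_deg 2 B0" unfolding B0_def
    using hom_deg_mult[OF hx hb] by (intro hom_deg_diff hB1) (simp add: numeral_2_eq_2)
  have hA0: "hom_deg 2 A0" unfolding A0_def by (intro hom_deg_diff hom_deg_power2 hx hA1)
  have hF: "hom_deg 4 F"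
    unfolding F_def using hom_deg_mult[OF hB0 hB0] hom_deg_mult[OF hom_deg_power2[OF hb] hA0]
    by (intro hom_deg_diff) (simp_all add: power2_eq_square)
  have reducible_member: False if "B1 + Cst t * A1 = c * d" "hom_deg 1 c" "hom_deg 1 d" for t c d
  proof -
    have "B1 + Cst t * A1 = Cst ((t - peval v B) * inverse (peval v A)) * A + Cst 1 * B"
      by (simp add: B1_def A1_def Cst_arith algebra_simps)
    moreover from this indep have "c * d \<noteq> 0" using that(1) by (metis zero_neq_one)
    ultimately show False using no_split[OF that(2,3)] that(1) by (metis mult_zero_left mult_zero_right zero_neq_one)
  qed
  have reducible_member': False if "A1 + Cst t * B1 = c * d" "hom_deg 1 c" "hom_deg 1 d" for t c d
  \<comment> \<open>The coefficient of \<open>A\<close> in \<open>A1 + t B1\<close> is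
    \<open>(1 - t B(v)) / A(v)\<close>; when it vanishes, the coefficient \<open>t\<close> of
    \<open>B\<close> does not.\<close>
  proof (cases "1 = t * peval v B")
    case True
    then have "t \<noteq> 0" by auto
    have "A1 + Cst t * B1 = Cst t * B"
      using True[symmetric] by (simp add: B1_def algebra_simps flip: Cst_arith(3) mult.assoc)
    then have eq: "Cst 0 * A + Cst t * B = c * d" using that by simp
    then have "c * d \<noteq> 0" using indep \<open>t \<noteq> 0\<close> by metis
    then show False using no_split[OF that(2,3) _ _ _ ] eq \<open>t \<noteq> 0\<close> by (metis mult_zero_left mult_zero_right)
  next
    case False
    have eq: "Cst ((1 - t * peval v B) * inverse (peval v A)) * A + Cst t * B = c * d"
      using that(1) by (simp add: B1_def A1_def Cst_arith algebra_simps)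
    have nz: "(1 - t * peval v B) * inverse (peval v A) \<noteq> 0" using False v(1) by simp
    then have "c * d \<noteq> 0" using indep eq by metis
    then show False using no_split[OF that(2,3)] eq nz by (metis mult_zero_left mult_zero_right)
  qed
  have nb: "\<not> b dvd B0"
  proof
    assume "b dvd B0"
    then have "b dvd B0 + x * b" by simp
    then obtain k where k: "B1 = b * k" by (auto simp: B0_def elim: dvdE)
    have "hom_deg (1 + 1) (b * k)" using hB1 k by (simp add: numeral_2_eq_2)
    then have "hom_deg 1 k" by (rule hom_deg_quotient[OF _ hb b0])
    then show False using reducible_member[of 0 b k] k hb by simp
  qed
  have pb: "prime_elem b" by (rule linear_prime_elem[OF hb b0])
  have nbF: "\<not> b dvd F"
  proof
    assume "b dvd F"
    moreover have "B0 * B0 = F + b * (b * A0)" by (simp add: F_def algebra_simps power2_eq_square)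
    ultimately have "b dvd B0 * B0" by simp
    then show False using pb nb by (auto simp: prime_elem_def)
  qed
  have F0: "F \<noteq> 0" using nbF by auto
  define q where "q k = peval v (Q k)" for k
  \<comment> \<open>Subtracting \<open>q k\<close> times \<open>A1\<close> from \<open>Q k\<close>
    removes the square of \<open>x\<close>; \<open>c k\<close>, the polar form of the difference at
    \<open>v\<close>, is then the coefficient of \<open>x\<close>.\<close>
  define c where "c k = polar v (Q k) - Cst (2 * q k) * x" for k
  define D where "D k = Q k - Cst (q k) * A1 - x * c k" for k
  define G where "G k = b * D k - B0 * c k" for k
  have hc: "hom_deg 1 (c k)" if "k \<in> K" for k
    unfolding c_def by (intro hom_deg_diff hom_deg_scale hom_deg_polar Q that hx)
  have hD: "hom_deg 2 (D k)" if "k \<in> K" for k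
    unfolding D_def using hom_deg_mult[OF hx hc[OF that]]
    by (intro hom_deg_diff hom_deg_scale Q that hA1) (simp add: numeral_2_eq_2)
  have hG: "hom_deg 3 (G k)" if "k \<in> K" for k
    unfolding G_def using hom_deg_mult[OF hb hD[OF that]] hom_deg_mult[OF hB0 hc[OF that]]
    by (intro hom_deg_diff) (simp_all add: numeral_3_eq_3 numeral_2_eq_2)
  define \<Phi> where "\<Phi> = shift v b (- B1)"
  have \<Phi>_quad: "\<Phi> p = b\<^sup>2 * p - b * B1 * polar v p + B1\<^sup>2 * Cst (peval v p)" if "hom_deg 2 p" for p
    unfolding \<Phi>_def shift_quadratic[OF that] by simp
  have \<Phi>B1: "\<Phi> B1 = 0"
    unfolding \<Phi>_quad[OF hB1] evB1 by (simp add: b_def power2_eq_square mult.commute mult.left_commute)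
  have \<Phi>A1: "\<Phi> A1 = F"
    unfolding \<Phi>_quad[OF hA1] evA1 polA1 F_def A0_def B0_def by (simp add: algebra_simps power2_eq_square)
  have \<Phi>Q: "\<Phi> (Q k) = b * G k + Cst (q k) * F" if "k \<in> K" for k
  proof -
    have "polar v (Q k) = c k + Cst (2 * q k) * x" by (simp add: c_def)
    then have "\<Phi> (Q k) = b\<^sup>2 * Q k - b * B1 * (c k + Cst (2 * q k) * x) + B1\<^sup>2 * Cst (q k)"
      using \<Phi>_quad[OF Q[OF that]] by (simp add: q_def)
    also have "\<dots> = b * G k + Cst (q k) * F"
      unfolding G_def D_def F_def A0_def B0_def by (simp add: Cst_arith algebra_simps power2_eq_square)
    finally show ?thesis .
  qed
  have dvd_G: "\<exists>k\<in>K. f dvd G k" if f: "prime_elem f" "f dvd F" "\<not> f dvd b" for f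
  proof -
    have "r * A + s * B = (r * Cst (peval v A) + s * Cst (peval v B)) * A1 + s * B1"
      by (subst A_A1, subst B_B1) (simp add: algebra_simps)
    then have "\<Phi> ((\<Prod>k\<in>K. Q k) ^ n) = \<Phi> (r * Cst (peval v A) + s * Cst (peval v B)) * F"
      unfolding rs by (simp add: \<Phi>_def ring_homD(2,3)[OF ring_hom_shift] \<Phi>A1[unfolded \<Phi>_def] \<Phi>B1[unfolded \<Phi>_def])
    then have "f dvd \<Phi> ((\<Prod>k\<in>K. Q k) ^ n)" using f(2) by simp
    then have "f dvd (\<Prod>k\<in>K. \<Phi> (Q k)) ^ n"
      by (simp add: \<Phi>_def ring_homD(7)[OF ring_hom_shift] ring_hom_prod[OF ring_hom_shift])
    then have "f dvd (\<Prod>k\<in>K. \<Phi> (Q k))" using f(1) prime_elem_dvd_power by blast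
    then obtain k where k: "k \<in> K" "f dvd \<Phi> (Q k)"
      using prime_elem_dvd_prod[OF f(1) assms(1)] by blast
    then have "f dvd b * G k" using f(2) by (simp add: \<Phi>Q dvd_add_left_iff)
    then show ?thesis using f(1,3) k(1) by (auto simp: prime_elem_def)
  qed
  have linear_factor: ?thesis if l: "hom_deg 1 l" "l \<noteq> 0" "l dvd F" for l
  proof -
    have "\<not> l dvd b"
    proof
      assume "l dvd b"
      then obtain e where e: "e \<noteq> 0" "b = Cst e * l" using hom_deg_same_dvd[OF l(1) hb _ b0] by blast
      then have "l = b * Cst (inverse e)" using Cst_cancel(2)[OF e(1), of l] by (simp add: mult.commute)
      then show False using l(3) nbF by (metis dvd_trans dvd_triv_left)
    qed
    then obtain k where k: "k \<in> K" "l dvd b * D k - B0 * c k"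
      using dvd_G[OF linear_prime_elem[OF l(1,2)] l(3)] unfolding G_def by blast
    obtain u where u: "hom_deg 1 u" "x\<^sup>2 - A0 \<in> ideal_gen {u, l}" "x * b + B0 \<in> ideal_gen {u, l}"
        "x * c k + D k \<in> ideal_gen {u, l}"
      using linear_factor_case[OF hb b0 hB0 nb l(1,2) hx l(3)[unfolded F_def]] k(2) by blast
    have A1I: "A1 \<in> ideal_gen {u, l}" and B1I: "B1 \<in> ideal_gen {u, l}"
      using u(2,3) by (simp_all add: A0_def B0_def)
    have "x * c k + D k + Cst (q k) * A1 \<in> ideal_gen {u, l}"
      by (intro ideal_gen_add ideal_gen_mult u(4) A1I)
    then have QI: "Q k \<in> ideal_gen {u, l}" by (simp add: D_def)
    have AI: "A \<in> ideal_gen {u, l}" and BI: "B \<in> ideal_gen {u, l}"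
      by (subst A_A1 B_B1, intro ideal_gen_add ideal_gen_mult A1I B1I)+
    \<comment> \<open>\<open>u\<close> may be 0; then \<open>l\<close> serves as both linear
      forms.\<close>
    have "\<exists>u'. hom_deg 1 u' \<and> u' \<noteq> 0 \<and> ideal_gen {u, l} \<subseteq> ideal_gen {u', l}"
    proof (cases "u = 0")
      case True
      then have "ideal_gen {u, l} \<subseteq> ideal_gen {l, l}" using ideal_gen_zero by blast
      then show ?thesis using l by blast
    qed (use u in blast)
    then show ?thesis using l(1,2) k(1) AI BI QI by blast
  qed
  show ?thesis
  proof (cases "irreducible F")
    case True
    then have "prime_elem F" by (rule cpoly_irreducible_imp_prime_elem)
    moreover have "\<not> F dvd b" using hom_deg_dvd_le[OF hF hb _ b0] by auto
    ultimately obtain k where k: "k \<in> K" "F dvd G k" using dvd_G[of F] by auto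
    then have "G k = 0" using hom_deg_dvd_le[OF hF hG] by fastforce
    \<comment> \<open>\<open>G k = 0\<close> means that \<open>x c_k + D_k\<close> and
      \<open>B1 = x b + B0\<close> are proportional. As the prime \<open>b\<close> does not divide
      \<open>B0\<close>, the ratio is a constant \<open>t\<close>.\<close>
    then have bD: "b * D k = B0 * c k" by (simp add: G_def)
    then have "b dvd B0 * c k" by (metis dvd_triv_left)
    then have "b dvd c k" using pb nb by (auto simp: prime_elem_def)
    then have "\<exists>t. c k = Cst t * b"
      using hom_deg_same_dvd[OF hb hc[OF k(1)]] by (metis Cst_simps(2) mult_zero_left)
    then obtain t where t: "c k = Cst t * b" ..
    have "b * D k = b * (Cst t * B0)" using bD t by (simp add: algebra_simps)
    then have "D k = Cst t * B0" using b0 by simp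
    then have "Q k = Cst (q k) * A1 + Cst t * B1"
      using t by (simp add: D_def B0_def algebra_simps diff_eq_eq)
    also have "\<dots> = Cst ((q k - t * peval v B) * inverse (peval v A)) * A + Cst t * B"
      by (simp add: A1_def B1_def Cst_arith algebra_simps)
    finally show ?thesis using no_span[OF k(1)] by blast
  next
    case False
    then obtain i j f g where fg: "F = f * g" "hom_deg i f" "hom_deg j g" "i > 0" "j > 0" "i + j = 4"
      using reducible_hom_deg[OF hF F0] by auto
    from fg(4-6) consider "i = 1" | "j = 1" | "i = 2" "j = 2" by linarith
    then show ?thesis
    proof cases
      case 1
      then show ?thesis using linear_factor[of f] fg F0 by auto
    next
      case 2
      then show ?thesis using linear_factor[of g] fg F0 by auto
    next
      case 3
      then have "hom_deg 2 f" "hom_deg 2 g" using fg by simp_all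
      from quadratic_factors_case[OF hb b0 hB0 nb this fg(1)[symmetric, unfolded F_def]]
      consider l where "hom_deg 1 l" "l \<noteq> 0" "l dvd f"
        | m t where "hom_deg 1 m" "A0 = m\<^sup>2 - Cst t * b * m - Cst t * B0" by blast
      then show ?thesis
      proof cases
        case 1
        then show ?thesis using linear_factor[of l] fg(1) by auto
      next
        case (2 m t)
        have "A1 = x\<^sup>2 - A0" by (simp add: A0_def)
        then have "A1 + Cst (- t) * B1 = (x - m) * (x + m - Cst t * b)"
          unfolding 2(2) B0_def by (simp add: Cst_arith algebra_simps power2_eq_square)
        moreover have "hom_deg 1 (x - m)" "hom_deg 1 (x + m - Cst t * b)"
          by (intro hom_deg_diff hom_deg_add hom_deg_scale hx 2(1) hb)+
        ultimately show ?thesis using reducible_member' by blast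
      qed
    qed
  qed
qed

section \<open>Transfer to an unordered finite set of variables\<close>

lemma hom_deg_conv_homogeneous:
  fixes p :: "('n::finite) cpoly"
  shows "homogeneous d p \<longleftrightarrow> hom_deg d p"
proof -
  have "mdeg m = (\<Sum>i\<in>Poly_Mapping.keys m. Poly_Mapping.lookup m i)" for m :: "'n \<Rightarrow>\<^sub>0 nat"
    unfolding mdeg_def by (rule sum.mono_neutral_right) (auto simp: in_keys_iff)
  then show ?thesis by (simp add: homogeneous_def hom_deg_iff)
qed

lemma linear_form_iff: "linear_form p \<longleftrightarrow> hom_deg 1 p \<and> p \<noteq> 0"
  by (simp add: linear_form_def hom_deg_conv_homogeneous)

lemma cscale_conv_Cst: "cscale a p = Cst a * p"
  by (simp add: cscale_def Cst_def)

theorem theorem3p1: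
  fixes K :: "'k set"
    and Q :: "'k \<Rightarrow> ('n::finite) cpoly"
    and A B :: "'n cpoly"
  assumes "finite K"
    and "\<And>k. k \<in> K \<Longrightarrow> homogeneous 2 (Q k)"
    and "homogeneous 2 A"
    and "homogeneous 2 B"
    and "(\<Prod>k\<in>K. Q k) \<in> radical (ideal_gen {A, B})"
  shows "(\<exists>k\<in>K. Q k \<in> clinear_span {A, B})
       \<or> (\<exists>\<alpha> \<beta> c d. (\<alpha> \<noteq> 0 \<or> \<beta> \<noteq> 0) \<and> linear_form c \<and> linear_form d
             \<and> cscale \<alpha> A + cscale \<beta> B = c * d)
       \<or> (\<exists>c d. linear_form c \<and> linear_form d
             \<and> A \<in> ideal_gen {c, d} \<and> B \<in> ideal_gen {c, d}
             \<and> (\<exists>k\<in>K. Q k \<in> ideal_gen {c, d}))"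
proof (rule ccontr)
  assume "\<not> ?thesis"
  then have no_span: "\<And>k \<alpha> \<beta>. k \<in> K \<Longrightarrow> Q k \<noteq> Cst \<alpha> * A + Cst \<beta> * B"
    and no_split: "\<And>\<alpha> \<beta> c d. \<alpha> \<noteq> 0 \<or> \<beta> \<noteq> 0 \<Longrightarrow> hom_deg 1 c \<Longrightarrow> hom_deg 1 d \<Longrightarrow> c \<noteq> 0 \<Longrightarrow> d \<noteq> 0
        \<Longrightarrow> Cst \<alpha> * A + Cst \<beta> * B \<noteq> c * d"
    and no_ideal: "\<And>c d k. hom_deg 1 c \<Longrightarrow> hom_deg 1 d \<Longrightarrow> c \<noteq> 0 \<Longrightarrow> d \<noteq> 0 \<Longrightarrow> k \<in> K
        \<Longrightarrow> A \<in> ideal_gen {c, d} \<Longrightarrow> B \<in> ideal_gen {c, d} \<Longrightarrow> Q k \<in> ideal_gen {c, d} \<Longrightarrow> False"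
    unfolding clinear_span_pair linear_form_iff cscale_conv_Cst by blast+
  note Q = assms(2)[unfolded hom_deg_conv_homogeneous]
  note A = assms(3)[unfolded hom_deg_conv_homogeneous]
  note B = assms(4)[unfolded hom_deg_conv_homogeneous]
  obtain n r s where rs: "(\<Prod>k\<in>K. Q k) ^ n = r * A + s * B"
    using assms(5) unfolding radical_def ideal_gen_pair by blast
  \<comment> \<open>The type \<open>'n\<close> carries no order, so its variables are embedded by
    \<open>E\<close> among those indexed by \<open>nat\<close>. The left inverse \<open>R\<close>
    sends the additional variables to 0.\<close>
  obtain idx :: "'n \<Rightarrow> nat" where idx: "inj idx"
    using finite_imp_inj_to_nat_seg[of "UNIV :: 'n set"] by auto
  define E :: "'n cpoly \<Rightarrow> nat cpoly" where "E = psubst Cst (\<lambda>i. Var (idx i))"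
  define R :: "nat cpoly \<Rightarrow> 'n cpoly" where
    "R = psubst Cst (\<lambda>j. if j \<in> range idx then Var (inv idx j) else 0)"
  have E: "ring_hom E" and R: "ring_hom R"
    unfolding E_def R_def by (rule ring_hom_psubst[OF ring_hom_Cst])+
  note E_simps = ring_homD[OF E] and R_simps = ring_homD[OF R]
  have E_Cst: "E (Cst c) = Cst c" and E_Var: "E (Var i) = Var (idx i)" for c i
    unfolding E_def by (simp_all add: ring_hom_Cst)
  have R_Cst: "R (Cst c) = Cst c" and R_Var: "R (Var j) = (if j \<in> range idx then Var (inv idx j) else 0)" for c j
    unfolding R_def by (simp_all add: ring_hom_Cst)
  have RE: "R (E p) = p" for p
    by (rule ring_hom_eqI[OF ring_hom_comp[OF R E] ring_hom_ident])
       (simp_all add: E_Cst E_Var R_Cst R_Var inv_f_f[OF idx])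
  have E_deg: "hom_deg d (E p)" if "hom_deg d p" for d p
    by (rule hom_deg_hom[OF E E_Cst _ that]) (use hom_deg_Var in \<open>auto simp: E_Var\<close>)
  have R_deg: "hom_deg d (R p)" if "hom_deg d p" for d p
    by (rule hom_deg_hom[OF R R_Cst _ that]) (use hom_deg_Var in \<open>auto simp: R_Var\<close>)
  have R_ideal: "p \<in> ideal_gen {R c, R d}" if "E p \<in> ideal_gen {c, d}" for p c d
  proof -
    obtain r s where "E p = r * c + s * d" using \<open>E p \<in> _\<close> unfolding ideal_gen_pair by blast
    then have "p = R r * R c + R s * R d" using RE[of p] by (simp add: R_simps)
    then show ?thesis unfolding ideal_gen_pair by blast
  qed
  have "\<exists>c d. hom_deg 1 c \<and> hom_deg 1 d \<and> c \<noteq> 0 \<and> d \<noteq> 0 \<and> E A \<in> ideal_gen {c, d} \<and> E B \<in> ideal_gen {c, d}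
    \<and> (\<exists>k\<in>K. E (Q k) \<in> ideal_gen {c, d})"
  proof (rule quadric_pencil_main[OF assms(1)])
    have "(\<Prod>k\<in>K. E (Q k)) ^ n = E ((\<Prod>k\<in>K. Q k) ^ n)"
      by (simp only: E_simps ring_hom_prod[OF E])
    then show "(\<Prod>k\<in>K. E (Q k)) ^ n = E r * E A + E s * E B"
      by (simp only: rs E_simps)
    show "E (Q k) \<noteq> Cst \<alpha> * E A + Cst \<beta> * E B" if k: "k \<in> K" for k \<alpha> \<beta>
    proof
      assume "E (Q k) = Cst \<alpha> * E A + Cst \<beta> * E B"
      then have "R (E (Q k)) = R (Cst \<alpha> * E A + Cst \<beta> * E B)" by simp
      then show False using no_span[OF k] by (simp add: R_simps R_Cst RE)
    qed
    show "Cst \<alpha> * E A + Cst \<beta> * E B \<noteq> c * d"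
      if cd: "hom_deg 1 c" "hom_deg 1 d" "c \<noteq> 0" "d \<noteq> 0" and \<alpha>\<beta>: "\<alpha> \<noteq> 0 \<or> \<beta> \<noteq> 0" for \<alpha> \<beta> c d
    proof
      assume eq: "Cst \<alpha> * E A + Cst \<beta> * E B = c * d"
      then have "R (Cst \<alpha> * E A + Cst \<beta> * E B) = R (c * d)" by simp
      then have eq': "Cst \<alpha> * A + Cst \<beta> * B = R c * R d" by (simp add: R_simps R_Cst RE)
      \<comment> \<open>\<open>R\<close> can kill linear forms, but not these two: their product
        comes from a nonzero polynomial in the original variables.\<close>
      have "E (Cst \<alpha> * A + Cst \<beta> * B) \<noteq> 0" using eq cd by (simp add: E_simps E_Cst)
      then have "R c * R d \<noteq> 0" unfolding eq' using E_simps(4) by metis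
      then have "R c \<noteq> 0" "R d \<noteq> 0" by auto
      then show False using no_split[OF \<alpha>\<beta> R_deg[OF cd(1)] R_deg[OF cd(2)]] eq' by blast
    qed
  qed (use Q A B in \<open>auto intro: E_deg\<close>)
  then obtain c d k where cd: "hom_deg 1 c" "hom_deg 1 d" and k: "k \<in> K"
    and "E A \<in> ideal_gen {c, d}" "E B \<in> ideal_gen {c, d}" "E (Q k) \<in> ideal_gen {c, d}"
    by blast
  then have I: "A \<in> ideal_gen {R c, R d}" "B \<in> ideal_gen {R c, R d}" "Q k \<in> ideal_gen {R c, R d}"
    by (auto intro: R_ideal)
  note deg = R_deg[OF cd(1)] R_deg[OF cd(2)]
  \<comment> \<open>The linear forms found over \<open>nat\<close> may vanish under
    \<open>R\<close>. If both do, \<open>Q k\<close> is 0 and lies in the span; if one does, the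
    other is used twice.\<close>
  consider "R c = 0" "R d = 0" | "R c = 0" "R d \<noteq> 0" | "R c \<noteq> 0" "R d = 0" | "R c \<noteq> 0" "R d \<noteq> 0" by blast
  then show False
  proof cases
    case 1
    then have "Q k = 0" using I(3) unfolding ideal_gen_pair by auto
    then show False using no_span[OF k, of 0 0] by simp
  next
    case 2
    then show False using no_ideal[OF deg(2,2) _ _ k] I[unfolded 2, THEN ideal_gen_zero] by blast
  next
    case 3
    then show False
      using no_ideal[OF deg(1,1) _ _ k] I[unfolded 3 insert_commute[of "R c"], THEN ideal_gen_zero] by blast
  next
    case 4
    then show False using no_ideal[OF deg _ _ k] I by blast
  qed
qed

end
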